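(* Let $G$ be a graph of order $n$. Then $\phi'(G)\le 10^{n/5}$. Furthermore, $\phi'(G)=10^{n/5}$ if and only if $n\equiv 0\pmod 5$ and $G$ is the disjoint union of $n/5$ graphs, each of which is isomorphic to a graph obtained from $K_5$ by deleting $i$ pairwise non-adjacent edges (a matching of size $i$) for some $0\le i\le 2$.
   Context: All graphs are finite, simple, undirected and labeled. A subset $F$ of vertices of a graph $G$ is a dissociation set if the induced subgraph $G[F]$ has maximum degree at most $1$. A maximum dissociation set is a dissociation set of maximum cardinality. $\phi'(G)$ denotes the number of maximum dissociation sets of $G$. *)

theory Defs
  imports Complex_Main "HOL-Library.Disjoint_Sets"
begin

definition simple_graph :: "'a set \<Rightarrow> ('a \<Rightarrow> 'a \<Rightarrow> bool) \<Rightarrow> bool" where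
  "simple_graph V E \<longleftrightarrow> finite V \<and> (\<forall>x y. E x y \<longrightarrow> E y x)
     \<and> (\<forall>x. \<not> E x x) \<and> (\<forall>x y. E x y \<longrightarrow> x \<in> V \<and> y \<in> V)"

definition dissociation_set :: "'a set \<Rightarrow> ('a \<Rightarrow> 'a \<Rightarrow> bool) \<Rightarrow> 'a set \<Rightarrow> bool" where
  "dissociation_set V E F \<longleftrightarrow> F \<subseteq> V \<and> (\<forall>x\<in>F. card {y\<in>F. E x y} \<le> 1)"

definition max_dissociation_set :: "'a set \<Rightarrow> ('a \<Rightarrow> 'a \<Rightarrow> bool) \<Rightarrow> 'a set \<Rightarrow> bool" where
  "max_dissociation_set V E F \<longleftrightarrow> dissociation_set V E F \<and>
     (\<forall>F'. dissociation_set V E F' \<longrightarrow> card F' \<le> card F)"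

definition num_max_dissociation :: "'a set \<Rightarrow> ('a \<Rightarrow> 'a \<Rightarrow> bool) \<Rightarrow> nat" where
  "num_max_dissociation V E = card {F. max_dissociation_set V E F}"

definition is_matching_K5 :: "nat set set \<Rightarrow> bool" where
  "is_matching_K5 M \<longleftrightarrow> (\<forall>e\<in>M. e \<subseteq> {0..<5} \<and> card e = 2)
     \<and> (\<forall>e\<in>M. \<forall>e'\<in>M. e \<noteq> e' \<longrightarrow> e \<inter> e' = {})"

definition K5_minus :: "nat set set \<Rightarrow> nat \<Rightarrow> nat \<Rightarrow> bool" where
  "K5_minus M u v \<longleftrightarrow> u \<in> {0..<5} \<and> v \<in> {0..<5} \<and> u \<noteq> v \<and> {u, v} \<notin> M"

definition induced_iso_K5_minus_matching :: "('a \<Rightarrow> 'a \<Rightarrow> bool) \<Rightarrow> 'a set \<Rightarrow> bool" where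
  "induced_iso_K5_minus_matching E B \<longleftrightarrow>
     (\<exists>M f. is_matching_K5 M \<and> card M \<le> 2 \<and> bij_betw f B {0..<5} \<and>
        (\<forall>x\<in>B. \<forall>y\<in>B. E x y \<longleftrightarrow> K5_minus M (f x) (f y)))"

definition disjoint_union_K5_minus_matchings :: "'a set \<Rightarrow> ('a \<Rightarrow> 'a \<Rightarrow> bool) \<Rightarrow> nat \<Rightarrow> bool" where
  "disjoint_union_K5_minus_matchings V E k \<longleftrightarrow>
     (\<exists>P. partition_on V P \<and> card P = k \<and>
        (\<forall>B\<in>P. induced_iso_K5_minus_matching E B) \<and>
        (\<forall>B\<in>P. \<forall>B'\<in>P. B \<noteq> B' \<longrightarrow> (\<forall>x\<in>B. \<forall>y\<in>B'. \<not> E x y)))"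

end

theory Submission
  imports Defs
begin

text \<open>
  Write \<open>\<phi>(U)\<close> for the number of maximum dissociation sets of the graph induced on \<open>U\<close>, and \<open>c = 10\<^sup>1\<^sup>/\<^sup>5\<close>.
  By strong induction \<open>\<phi>(U - R) \<le> c\<^bsup>|U|\<^esup> c\<^bsup>-|R|\<^esup>\<close> for every nonempty \<open>R\<close>. Prescribing the trace \<open>A\<close>
  of a maximum dissociation set on a set \<open>R\<close> that contains all neighbours of \<open>A\<close> leaves at most
  \<open>\<phi>(U - R)\<close> choices, so the sets containing \<open>v\<close> (isolated, or matched to a given neighbour) are
  few; moreover, if \<open>v\<close> is isolated in the set, then by maximality every neighbour of \<open>v\<close> has
  a neighbour in the set.

  If some vertex \<open>v\<close> has degree at least 4, splitting into the sets that avoid \<open>v\<close> and those that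
  contain it gives a strict inequality, unless the closed neighbourhood of \<open>v\<close> is a component with
  5 vertices; in that case \<open>\<phi>\<close> is multiplicative, and a component of this form contributes at most
  10, with equality exactly when all its pairs are maximum. If all degrees are at most 3, a maximal
  cut shows that maximum dissociation sets contain at least half of the vertices, whereas (after
  removing some degenerate cases) each vertex lies in fewer than \<open>c\<^bsup>|U|\<^esup> / 2\<close> of them; double counting
  yields a strict inequality.
\<close>

section \<open>Numerical estimates for the base of the bound\<close>

definition growth :: real where
  "growth = 10 powr (1 / 5)"

text \<open>In the induction every deleted vertex is worth a factor \<open>decay\<close> relative to
  \<open>growth ^ card U\<close>, so the case bounds become inequalities between powers of this
  constant, about 0.631.\<close>

definition decay :: real where
  "decay = 1 / growth"

lemma growth_power: "growth ^ n = 10 powr (real n / 5)"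
  unfolding growth_def by (simp add: powr_realpow[symmetric] powr_powr)

lemma growth_power5: "growth ^ 5 = 10"
  by (simp add: growth_power)

lemma growth_gt_1: "growth > 1"
  unfolding growth_def by simp

lemma growth_pos: "growth > 0"
  using growth_gt_1 by simp

lemma decay_pos: "decay > 0"
  unfolding decay_def using growth_pos by simp

lemma decay_power5: "decay ^ 5 = 1 / 10"
  unfolding decay_def by (simp add: power_divide growth_power5)

text \<open>0.632 ^ 5 is about 0.1008, just above \<open>decay ^ 5 = 1 / 10\<close>.\<close>

lemma decay_less: "decay < 632 / 1000"
proof (rule ccontr)
  assume "\<not> decay < 632 / 1000"
  then have "(632 / 1000) ^ 5 \<le> decay ^ 5"
    by (intro power_mono) auto
  then show False
    unfolding decay_power5 by (simp add: field_simps)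
qed

lemma decay_le_1: "decay \<le> 1"
  using decay_less by simp

lemma decay_power2_less: "decay ^ 2 < 3995 / 10000"
proof -
  have "decay ^ 2 < (632 / 1000) ^ 2"
    using decay_less decay_pos by (intro power_strict_mono) auto
  also have "\<dots> < 3995 / 10000"
    by (simp add: field_simps)
  finally show ?thesis .
qed

lemma decay_power3_less: "decay ^ 3 < 2525 / 10000"
proof -
  have "decay ^ 3 < (632 / 1000) ^ 3"
    using decay_less decay_pos by (intro power_strict_mono) auto
  also have "\<dots> < 2525 / 10000"
    by (simp add: field_simps)
  finally show ?thesis .
qed

lemma decay_power4_less: "decay ^ 4 < 1596 / 10000"
proof -
  have "decay ^ 4 < (632 / 1000) ^ 4"
    using decay_less decay_pos by (intro power_strict_mono) auto
  also have "\<dots> < 1596 / 10000"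
    by (simp add: field_simps)
  finally show ?thesis .
qed

lemma decay_power_antimono: "k \<le> m \<Longrightarrow> decay ^ m \<le> decay ^ k"
  using decay_le_1 decay_pos by (intro power_decreasing) auto

lemma growth_power_le_decay:
  assumes "m + k \<le> n"
  shows "growth ^ m \<le> growth ^ n * decay ^ k"
proof -
  have "growth ^ (m + k) \<le> growth ^ n"
    using assms growth_gt_1 by (intro power_increasing) auto
  then show ?thesis
    using growth_pos by (simp add: decay_def power_divide power_add field_simps)
qed

text \<open>The two sides agree at \<open>d = 5\<close> because \<open>decay ^ 5 = 1 / 10\<close>.
  Passing from \<open>d\<close> to \<open>d + 1\<close> multiplies the left side by
  \<open>(d + 1) * decay / d\<close>, which is at most 1. The estimate serves vertices of degree at
  least 5.\<close>

lemma linear_decay_le: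
  assumes "5 \<le> d"
  shows "real d * decay ^ (d + 1) \<le> decay / 2"
  using assms
proof (induction d rule: dec_induct)
  case base
  have "decay ^ (5 + 1) = decay / 10"
    unfolding power_add decay_power5 by simp
  then show ?case by simp
next
  case (step d)
  have "real (Suc d) * decay \<le> real d"
  proof -
    have "real (Suc d) * decay \<le> real (Suc d) * (632 / 1000)"
      using decay_less by (intro mult_left_mono) auto
    also have "\<dots> \<le> real d" using step by simp
    finally show ?thesis .
  qed
  then have "real (Suc d) * decay * decay ^ (d + 1) \<le> real d * decay ^ (d + 1)"
    using decay_pos by (intro mult_right_mono) auto
  then show ?case using step by (simp add: mult_ac)
qed

section \<open>Maximum dissociation sets of induced subgraphs\<close>

text \<open>Only the adjacency relation is fixed; the vertex set stays a parameter \<open>U\<close>,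
  so passing to an induced subgraph just means replacing \<open>U\<close> by a subset.\<close>

locale edge_relation =
  fixes E :: "'a \<Rightarrow> 'a \<Rightarrow> bool"
  assumes sym: "E x y \<Longrightarrow> E y x"
    and irrefl: "\<not> E x x"
begin

abbreviation phi :: "'a set \<Rightarrow> nat" where
  "phi U \<equiv> num_max_dissociation U E"

definition mds :: "'a set \<Rightarrow> 'a set set" where
  "mds U = {F. max_dissociation_set U E F}"

definition nbrs :: "'a set \<Rightarrow> 'a \<Rightarrow> 'a set" where
  "nbrs U v = {w \<in> U. E v w}"

definition cnbrs :: "'a set \<Rightarrow> 'a \<Rightarrow> 'a set" where
  "cnbrs U v = insert v (nbrs U v)"

lemma phi_eq: "phi U = card (mds U)"
  by (simp add: num_max_dissociation_def mds_def)

lemma finite_nbrs [simp]: "finite U \<Longrightarrow> finite (nbrs U v)"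
  by (simp add: nbrs_def)

lemma finite_cnbrs [simp]: "finite U \<Longrightarrow> finite (cnbrs U v)"
  by (simp add: cnbrs_def)

lemma nbrs_subset: "nbrs U v \<subseteq> U"
  by (auto simp: nbrs_def)

lemma cnbrs_subset: "v \<in> U \<Longrightarrow> cnbrs U v \<subseteq> U"
  by (auto simp: nbrs_def cnbrs_def)

lemma card_cnbrs: "finite U \<Longrightarrow> card (cnbrs U v) = Suc (card (nbrs U v))"
  unfolding cnbrs_def by (simp add: nbrs_def irrefl)

lemma dissociation_iff:
  assumes "finite U"
  shows "dissociation_set U E F \<longleftrightarrow>
    F \<subseteq> U \<and> (\<forall>x\<in>F. \<forall>y\<in>F. \<forall>z\<in>F. E x y \<and> E x z \<longrightarrow> y = z)"
proof (cases "F \<subseteq> U")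
  case True
  then have "finite F" using assms finite_subset by blast
  then have "card {y \<in> F. E x y} \<le> 1 \<longleftrightarrow> (\<forall>y\<in>F. \<forall>z\<in>F. E x y \<and> E x z \<longrightarrow> y = z)" for x
    using card_le_Suc0_iff_eq[of "{y \<in> F. E x y}"] by auto
  then show ?thesis using True unfolding dissociation_set_def by auto
qed (simp add: dissociation_set_def)

lemma mds_subset: "F \<in> mds U \<Longrightarrow> F \<subseteq> U"
  by (simp add: mds_def max_dissociation_set_def dissociation_set_def)

lemma finite_mds [simp]: "finite U \<Longrightarrow> finite (mds U)"
  by (rule finite_subset[of _ "Pow U"]) (auto dest: mds_subset)

lemma finite_member_mds: "finite U \<Longrightarrow> F \<in> mds U \<Longrightarrow> finite F"
  using mds_subset finite_subset by blast

lemma mds_matching: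
  assumes "finite U" "F \<in> mds U" "x \<in> F" "y \<in> F" "z \<in> F" "E x y" "E x z"
  shows "y = z"
  using assms by (auto simp: mds_def max_dissociation_set_def dissociation_iff)

lemma mds_card_ge:
  assumes "F \<in> mds U" "dissociation_set U E F'"
  shows "card F' \<le> card F"
  using assms by (auto simp: mds_def max_dissociation_set_def)

lemma mds_dissociation: "F \<in> mds U \<Longrightarrow> dissociation_set U E F"
  by (simp add: mds_def max_dissociation_set_def)

lemma mds_not_insert:
  assumes "finite U" "F \<in> mds U" "v \<notin> F"
  shows "\<not> dissociation_set U E (insert v F)"
  using mds_card_ge[OF assms(2)] finite_member_mds[OF assms(1,2)] assms(3) by fastforce

text \<open>An exchange argument: a dissociation set \<open>F'\<close> of \<open>U - R\<close> has
  no edges to \<open>F \<inter> R\<close>, so \<open>F' \<union> (F \<inter> R)\<close> is a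
  dissociation set of \<open>U\<close>, and maximality of \<open>F\<close> bounds
  \<open>card F'\<close> by \<open>card (F - R)\<close>.\<close>

lemma mds_Diff:
  assumes fin: "finite U" and F: "F \<in> mds U"
    and sep: "\<And>a w. a \<in> F \<inter> R \<Longrightarrow> w \<in> U - R \<Longrightarrow> \<not> E a w"
  shows "F - R \<in> mds (U - R)"
proof -
  have FU: "F \<subseteq> U" and finF: "finite F"
    using mds_subset[OF F] finite_member_mds[OF fin F] by auto
  have "dissociation_set (U - R) E (F - R)"
    using FU mds_matching[OF fin F] fin by (subst dissociation_iff) auto
  moreover have "card F' \<le> card (F - R)" if F': "dissociation_set (U - R) E F'" for F'
  proof -
    have F'sub: "F' \<subseteq> U - R"
      and F'm: "\<And>x y z. x \<in> F' \<Longrightarrow> y \<in> F' \<Longrightarrow> z \<in> F' \<Longrightarrow> E x y \<Longrightarrow> E x z \<Longrightarrow> y = z"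
      using F' fin by (auto simp: dissociation_iff)
    have finF': "finite F'" using F'sub fin finite_subset by blast
    have no: "\<not> E a w" "\<not> E w a" if "a \<in> F \<inter> R" "w \<in> F'" for a w
      using sep that F'sub sym by blast+
    have "y = z" if "x \<in> F' \<union> (F \<inter> R)" "y \<in> F' \<union> (F \<inter> R)" "z \<in> F' \<union> (F \<inter> R)"
      "E x y" "E x z" for x y z
    proof (cases "x \<in> F'")
      case True
      then have "y \<in> F'" "z \<in> F'" using no that by blast+
      then show ?thesis using F'm True that by blast
    next
      case False
      then have "x \<in> F \<inter> R" using that by blast
      then have "y \<in> F" "z \<in> F" "x \<in> F" using no that by blast+
      then show ?thesis using mds_matching[OF fin F] that by blast
    qed
    then have "dissociation_set U E (F' \<union> (F \<inter> R))"
      using fin F'sub FU by (subst dissociation_iff) blast+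
    then have "card (F' \<union> (F \<inter> R)) \<le> card F"
      using mds_card_ge[OF F] by blast
    moreover have "card (F' \<union> (F \<inter> R)) = card F' + card (F \<inter> R)"
      using F'sub finF finF' by (intro card_Un_disjoint) auto
    moreover have "card F = card (F - R) + card (F \<inter> R)"
      using finF card_Diff_subset_Int[of F R] card_mono[of F "F \<inter> R"] by auto
    ultimately show ?thesis by simp
  qed
  ultimately show ?thesis
    by (simp add: mds_def max_dissociation_set_def)
qed

text \<open>With the trace on \<open>R\<close> fixed, \<open>F\<close> is recovered from
  \<open>F - R\<close>, which is maximum in \<open>U - R\<close> by \<open>mds_Diff\<close>.\<close>

lemma card_mds_trace_le:
  assumes fin: "finite U" and sep: "\<And>a w. a \<in> A \<Longrightarrow> w \<in> U - R \<Longrightarrow> \<not> E a w"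
  shows "card {F \<in> mds U. F \<inter> R = A} \<le> phi (U - R)"
  unfolding phi_eq
proof (rule card_inj_on_le[of "\<lambda>F. F - R"])
  show "inj_on (\<lambda>F. F - R) {F \<in> mds U. F \<inter> R = A}"
    by (rule inj_onI) blast
  show "(\<lambda>F. F - R) ` {F \<in> mds U. F \<inter> R = A} \<subseteq> mds (U - R)"
    using mds_Diff[OF fin] sep by blast
qed (use fin in simp)

text \<open>Dissociation sets and their sizes split along \<open>C\<close>, since no edge leaves it.
  Hence a set is maximum exactly when both of its parts are, and maximum sets correspond to pairs of
  maximum sets.\<close>

lemma phi_union_closed:
  assumes fin: "finite U" and C: "C \<subseteq> U" and sep: "\<And>a w. a \<in> C \<Longrightarrow> w \<in> U - C \<Longrightarrow> \<not> E a w"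
  shows "phi U = phi C * phi (U - C)"
proof -
  have finC: "finite C" and finD: "finite (U - C)"
    using fin C finite_subset by auto
  have sep': "\<not> E w a" if "a \<in> C" "w \<in> U - C" for a w
    using sep sym that by blast
  have diss: "dissociation_set U E F \<longleftrightarrow> F \<subseteq> U \<and> dissociation_set C E (F \<inter> C)
      \<and> dissociation_set (U - C) E (F - C)" for F
  proof (cases "F \<subseteq> U")
    case True
    have "y \<in> C \<longleftrightarrow> x \<in> C" if "x \<in> F" "y \<in> F" "E x y" for x y
      using sep sep' that True by blast
    then have "(\<forall>x\<in>F. \<forall>y\<in>F. \<forall>z\<in>F. E x y \<and> E x z \<longrightarrow> y = z) \<longleftrightarrow>
        (\<forall>x\<in>F \<inter> C. \<forall>y\<in>F \<inter> C. \<forall>z\<in>F \<inter> C. E x y \<and> E x z \<longrightarrow> y = z) \<and>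
        (\<forall>x\<in>F - C. \<forall>y\<in>F - C. \<forall>z\<in>F - C. E x y \<and> E x z \<longrightarrow> y = z)"
      unfolding Ball_def Int_iff Diff_iff by meson
    moreover have "F \<inter> C \<subseteq> C" "F - C \<subseteq> U - C"
      using True by auto
    ultimately show ?thesis
      unfolding dissociation_iff[OF fin] dissociation_iff[OF finC] dissociation_iff[OF finD]
      using True by simp
  qed (simp add: dissociation_set_def)
  have card_split: "card F = card (F \<inter> C) + card (F - C)" if "F \<subseteq> U" for F
    using card_Un_disjoint[of "F \<inter> C" "F - C"] finite_subset[OF that fin]
    by (simp add: Int_Diff_Un Int_Diff_disjoint)
  have iff: "F \<in> mds U \<longleftrightarrow> F \<subseteq> U \<and> F \<inter> C \<in> mds C \<and> F - C \<in> mds (U - C)" for F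
  proof
    assume F: "F \<in> mds U"
    then have FU: "F \<subseteq> U" and dF: "dissociation_set C E (F \<inter> C)" "dissociation_set (U - C) E (F - C)"
      using mds_dissociation[OF F] diss by auto
    have "card A \<le> card (F \<inter> C)" if A: "dissociation_set C E A" for A
    proof -
      have "A \<subseteq> C" using A by (simp add: dissociation_set_def)
      then have "(A \<union> (F - C)) \<inter> C = A" "(A \<union> (F - C)) - C = F - C" by auto
      then have "dissociation_set U E (A \<union> (F - C))" and "card (A \<union> (F - C)) = card A + card (F - C)"
        using diss[of "A \<union> (F - C)"] card_split[of "A \<union> (F - C)"] A dF FU C \<open>A \<subseteq> C\<close> by auto
      then show ?thesis using mds_card_ge[OF F] card_split[OF FU] by fastforce
    qed
    moreover have "card A \<le> card (F - C)" if A: "dissociation_set (U - C) E A" for A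
    proof -
      have "A \<subseteq> U - C" using A by (simp add: dissociation_set_def)
      then have "(A \<union> (F \<inter> C)) \<inter> C = F \<inter> C" "(A \<union> (F \<inter> C)) - C = A" by auto
      then have "dissociation_set U E (A \<union> (F \<inter> C))" and "card (A \<union> (F \<inter> C)) = card A + card (F \<inter> C)"
        using diss[of "A \<union> (F \<inter> C)"] card_split[of "A \<union> (F \<inter> C)"] A dF FU C \<open>A \<subseteq> U - C\<close> by auto
      then show ?thesis using mds_card_ge[OF F] card_split[OF FU] by fastforce
    qed
    ultimately show "F \<subseteq> U \<and> F \<inter> C \<in> mds C \<and> F - C \<in> mds (U - C)"
      using FU dF by (auto simp: mds_def max_dissociation_set_def)
  next
    assume F: "F \<subseteq> U \<and> F \<inter> C \<in> mds C \<and> F - C \<in> mds (U - C)"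
    then have "dissociation_set U E F" using diss mds_dissociation by blast
    moreover have "card A \<le> card F" if "dissociation_set U E A" for A
      using that diss[of A] card_split[of A] card_split[of F] F
        mds_card_ge[of "F \<inter> C" C "A \<inter> C"] mds_card_ge[of "F - C" "U - C" "A - C"] by simp
    ultimately show "F \<in> mds U" by (simp add: mds_def max_dissociation_set_def)
  qed
  have "bij_betw (\<lambda>F. (F \<inter> C, F - C)) (mds U) (mds C \<times> mds (U - C))"
  proof (rule bij_betwI[where g = "\<lambda>(A, B). A \<union> B"])
    show "(\<lambda>(A, B). A \<union> B) \<in> mds C \<times> mds (U - C) \<rightarrow> mds U"
    proof safe
      fix A B assume AB: "A \<in> mds C" "B \<in> mds (U - C)"
      then have "A \<subseteq> C" "B \<subseteq> U - C" using mds_subset by auto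
      then have "(A \<union> B) \<inter> C = A" "(A \<union> B) - C = B" by auto
      then show "A \<union> B \<in> mds U" unfolding iff using AB \<open>A \<subseteq> C\<close> \<open>B \<subseteq> U - C\<close> C by auto
    qed
  qed (use iff in \<open>auto dest!: mds_subset\<close>)
  then show ?thesis
    unfolding phi_eq by (simp add: bij_betw_same_card card_cartesian_product)
qed

section \<open>Counting the sets through a fixed vertex\<close>

definition containing :: "'a set \<Rightarrow> 'a \<Rightarrow> 'a set set" where
  "containing U v = {F \<in> mds U. v \<in> F}"

definition isolating :: "'a set \<Rightarrow> 'a \<Rightarrow> 'a set set" where
  "isolating U v = {F \<in> mds U. v \<in> F \<and> F \<inter> nbrs U v = {}}"

text \<open>These vertices are deleted in addition to the closed neighbourhood of \<open>v\<close>
  when \<open>v\<close> and \<open>w\<close> are both chosen; their number is the extra exponent of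
  \<open>decay\<close> gained.\<close>

definition outer :: "'a set \<Rightarrow> 'a \<Rightarrow> 'a \<Rightarrow> 'a set" where
  "outer U v w = nbrs U w - cnbrs U v"

text \<open>The induction hypothesis as a predicate, so that the cases can be treated outside the
  induction.\<close>

definition bounded_on_proper_subsets :: "'a set \<Rightarrow> bool" where
  "bounded_on_proper_subsets U \<longleftrightarrow> (\<forall>W. W \<subset> U \<longrightarrow> real (phi W) \<le> growth ^ card W)"

lemma bounded_on_proper_subsets_subset: "bounded_on_proper_subsets U \<Longrightarrow> W \<subseteq> U \<Longrightarrow> bounded_on_proper_subsets W"
  unfolding bounded_on_proper_subsets_def by blast

lemma finite_outer [simp]: "finite U \<Longrightarrow> finite (outer U v w)"
  by (simp add: outer_def)

lemma growth_Diff_le: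
  assumes "finite U" "R \<subseteq> U" "k \<le> card R"
  shows "growth ^ card (U - R) \<le> growth ^ card U * decay ^ k"
proof (rule growth_power_le_decay)
  have "card (U - R) + card R = card U"
    using assms card_mono[of U R] finite_subset[of R U] by (simp add: card_Diff_subset)
  then show "card (U - R) + k \<le> card U" using assms by simp
qed

lemma phi_Diff_le:
  assumes "finite U" "bounded_on_proper_subsets U" "R \<subseteq> U" "R \<noteq> {}" "k \<le> card R"
  shows "real (phi (U - R)) \<le> growth ^ card U * decay ^ k"
proof -
  have "U - R \<subset> U" using assms by blast
  then have "real (phi (U - R)) \<le> growth ^ card (U - R)"
    using assms(2) unfolding bounded_on_proper_subsets_def by blast
  also have "\<dots> \<le> growth ^ card U * decay ^ k"
    using growth_Diff_le assms by blast
  finally show ?thesis .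
qed

lemma card_avoiding_le:
  assumes "finite U" "bounded_on_proper_subsets U" "v \<in> U"
  shows "real (card {F \<in> mds U. v \<notin> F}) \<le> growth ^ card U * decay"
proof -
  have "{F \<in> mds U. v \<notin> F} = {F \<in> mds U. F \<inter> {v} = {}}" by auto
  then have "card {F \<in> mds U. v \<notin> F} \<le> phi (U - {v})"
    using card_mds_trace_le[OF assms(1), of "{}" "{v}"] by simp
  then show ?thesis
    using phi_Diff_le[of U "{v}" 1] assms by simp
qed

lemma card_isolating_le:
  assumes "finite U" "bounded_on_proper_subsets U" "v \<in> U"
  shows "real (card (isolating U v)) \<le> growth ^ card U * decay ^ (card (nbrs U v) + 1)"
proof -
  have "v \<notin> nbrs U v" by (simp add: nbrs_def irrefl)
  then have "isolating U v = {F \<in> mds U. F \<inter> cnbrs U v = {v}}"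
    by (auto simp: isolating_def cnbrs_def set_eq_iff)
  moreover have "\<not> E a w" if "a \<in> {v}" "w \<in> U - cnbrs U v" for a w
    using that by (auto simp: cnbrs_def nbrs_def)
  ultimately have "card (isolating U v) \<le> phi (U - cnbrs U v)"
    using card_mds_trace_le[OF assms(1), of "{v}" "cnbrs U v"] by simp
  moreover have "real (phi (U - cnbrs U v)) \<le> growth ^ card U * decay ^ (card (nbrs U v) + 1)"
    using assms cnbrs_subset[OF assms(3)] card_cnbrs[OF assms(1), of v]
    by (intro phi_Diff_le) (auto simp: cnbrs_def)
  ultimately show ?thesis by linarith
qed

text \<open>The edge between \<open>v\<close> and \<open>w\<close> uses up the allowed degree of
  both ends, so the trace on the union of their closed neighbourhoods is exactly
  \<open>{v, w}\<close>.\<close>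

lemma card_matched_le:
  assumes fin: "finite U" and bd: "bounded_on_proper_subsets U" and v: "v \<in> U" and w: "w \<in> nbrs U v"
  shows "real (card {F \<in> mds U. v \<in> F \<and> w \<in> F})
    \<le> growth ^ card U * decay ^ (card (nbrs U v) + 1 + card (outer U v w))"
proof -
  let ?R = "cnbrs U v \<union> cnbrs U w"
  have wU: "w \<in> U" and Evw: "E v w" "E w v"
    using w sym by (auto simp: nbrs_def)
  have "{F \<in> mds U. v \<in> F \<and> w \<in> F} \<subseteq> {F \<in> mds U. F \<inter> ?R = {v, w}}"
    using mds_matching[OF fin] Evw by (auto simp: cnbrs_def nbrs_def)
  then have "card {F \<in> mds U. v \<in> F \<and> w \<in> F} \<le> card {F \<in> mds U. F \<inter> ?R = {v, w}}"
    using fin by (intro card_mono) auto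
  also have "\<dots> \<le> phi (U - ?R)"
    by (rule card_mds_trace_le[OF fin]) (auto simp: cnbrs_def nbrs_def)
  finally have 1: "card {F \<in> mds U. v \<in> F \<and> w \<in> F} \<le> phi (U - ?R)" .
  have "?R = cnbrs U v \<union> outer U v w"
    using w by (auto simp: outer_def cnbrs_def)
  moreover have "card (cnbrs U v \<union> outer U v w) = card (cnbrs U v) + card (outer U v w)"
    using fin by (intro card_Un_disjoint) (auto simp: outer_def)
  ultimately have "card ?R = card (nbrs U v) + 1 + card (outer U v w)"
    using fin by (simp add: card_cnbrs)
  moreover have "?R \<subseteq> U" "?R \<noteq> {}"
    using cnbrs_subset v wU by (auto simp: cnbrs_def)
  ultimately have "real (phi (U - ?R)) \<le> growth ^ card U * decay ^ (card (nbrs U v) + 1 + card (outer U v w))"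
    by (intro phi_Diff_le[OF fin bd]) auto
  then show ?thesis using 1 by linarith
qed

text \<open>Otherwise \<open>w\<close> could be added to \<open>F\<close>: its only neighbour in
  \<open>F\<close> would be \<open>v\<close>, which has no neighbour in \<open>F\<close> itself.
  This contradicts maximality.\<close>

lemma isolating_blocked:
  assumes fin: "finite U" and F: "F \<in> isolating U v" and w: "w \<in> nbrs U v"
  shows "F \<inter> outer U v w \<noteq> {}"
proof
  assume empty: "F \<inter> outer U v w = {}"
  have FM: "F \<in> mds U" and vF: "v \<in> F" and no: "F \<inter> nbrs U v = {}"
    using F by (auto simp: isolating_def)
  have wF: "w \<notin> F" and wU: "w \<in> U" using no w nbrs_subset by auto
  have FU: "F \<subseteq> U" using mds_subset[OF FM] .
  have onlyv: "x = v" if "x \<in> F" "E w x \<or> E x w" for x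
    using that empty no FU sym by (auto simp: outer_def cnbrs_def nbrs_def)
  have onlyw: "x = w" if "x \<in> insert w F" "E v x" for x
    using that no FU by (auto simp: nbrs_def)
  have "y = z" if "x \<in> insert w F" "y \<in> insert w F" "z \<in> insert w F" "E x y" "E x z" for x y z
    using that onlyv onlyw mds_matching[OF fin FM] irrefl by (metis insertE)
  then have "dissociation_set U E (insert w F)"
    using fin FU wU by (subst dissociation_iff) blast+
  then show False using mds_not_insert[OF fin FM wF] by blast
qed

text \<open>In such a set \<open>v\<close> is either isolated or chosen together with a neighbour;
  the estimate is the union bound over these classes.\<close>

lemma card_containing_le:
  assumes fin: "finite U" and bd: "bounded_on_proper_subsets U" and v: "v \<in> U"
  shows "real (card (containing U v)) \<le> real (card (isolating U v))
    + growth ^ card U * decay ^ (card (nbrs U v) + 1) * (\<Sum>w\<in>nbrs U v. decay ^ card (outer U v w))"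
proof -
  let ?m = "\<lambda>w. {F \<in> mds U. v \<in> F \<and> w \<in> F}"
  have "containing U v \<subseteq> isolating U v \<union> (\<Union>w\<in>nbrs U v. ?m w)"
    by (auto simp: containing_def isolating_def)
  then have "card (containing U v) \<le> card (isolating U v \<union> (\<Union>w\<in>nbrs U v. ?m w))"
    using fin by (intro card_mono) (auto simp: isolating_def)
  also have "\<dots> \<le> card (isolating U v) + (\<Sum>w\<in>nbrs U v. card (?m w))"
    using card_Un_le[of "isolating U v" "\<Union>w\<in>nbrs U v. ?m w"]
      card_UN_le[of "nbrs U v" ?m] fin by simp
  finally have "real (card (containing U v)) \<le> real (card (isolating U v)) + (\<Sum>w\<in>nbrs U v. real (card (?m w)))"
    by (simp flip: of_nat_sum of_nat_add)
  also have "(\<Sum>w\<in>nbrs U v. real (card (?m w))) \<le>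
      (\<Sum>w\<in>nbrs U v. growth ^ card U * decay ^ (card (nbrs U v) + 1 + card (outer U v w)))"
    using card_matched_le[OF fin bd v] by (intro sum_mono)
  also have "\<dots> = growth ^ card U * decay ^ (card (nbrs U v) + 1) * (\<Sum>w\<in>nbrs U v. decay ^ card (outer U v w))"
    by (simp add: sum_distrib_left power_add mult_ac)
  finally show ?thesis by simp
qed

lemma isolating_empty:
  assumes "finite U" "w \<in> nbrs U v" "outer U v w = {}"
  shows "isolating U v = {}"
  using isolating_blocked[OF assms(1) _ assms(2)] assms(3) by blast

lemma card_containing_blocked_le:
  assumes fin: "finite U" and bd: "bounded_on_proper_subsets U" and v: "v \<in> U"
    and w: "w \<in> nbrs U v" "outer U v w = {}"
  shows "real (card (containing U v)) \<le>
    growth ^ card U * decay ^ (card (nbrs U v) + 1) * (\<Sum>w\<in>nbrs U v. decay ^ card (outer U v w))"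
  using card_containing_le[OF fin bd v] isolating_empty[OF fin w] by simp

lemma card_containing_open_le:
  assumes fin: "finite U" and bd: "bounded_on_proper_subsets U" and v: "v \<in> U"
    and out: "\<And>w. w \<in> nbrs U v \<Longrightarrow> outer U v w \<noteq> {}"
  shows "real (card (containing U v)) \<le>
    growth ^ card U * decay ^ (card (nbrs U v) + 1) * (1 + real (card (nbrs U v)) * decay)"
proof -
  let ?t = "growth ^ card U * decay ^ (card (nbrs U v) + 1)"
  have "decay ^ card (outer U v w) \<le> decay" if "w \<in> nbrs U v" for w
    using decay_power_antimono[of 1 "card (outer U v w)"] out[OF that] fin
    by (simp add: Suc_le_eq card_gt_0_iff)
  then have "(\<Sum>w\<in>nbrs U v. decay ^ card (outer U v w)) \<le> real (card (nbrs U v)) * decay"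
    using sum_bounded_above[of "nbrs U v" "\<lambda>w. decay ^ card (outer U v w)" decay] by simp
  then have "?t * (\<Sum>w\<in>nbrs U v. decay ^ card (outer U v w)) \<le> ?t * (real (card (nbrs U v)) * decay)"
    using growth_pos decay_pos by (intro mult_left_mono) auto
  then show ?thesis
    using card_containing_le[OF fin bd v] card_isolating_le[OF fin bd v]
    by (simp add: algebra_simps)
qed

lemma sum_decay_outer_le: "(\<Sum>w\<in>nbrs U v. decay ^ card (outer U v w)) \<le> real (card (nbrs U v))"
  using sum_bounded_above[of "nbrs U v" "\<lambda>w. decay ^ card (outer U v w)" 1]
    decay_le_1 decay_pos by (simp add: power_le_one)

text \<open>Let \<open>d\<close> be the degree and count in units of
  \<open>growth ^ card U * decay ^ (d + 1)\<close>. If some neighbour has no outer neighbours,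
  \<open>v\<close> is never isolated and the \<open>d\<close> matched classes count at most 1 each.
  Otherwise the isolated class counts at most 1 and each matched class at most
  \<open>decay\<close>.\<close>

lemma card_containing_le_max:
  assumes fin: "finite U" and bd: "bounded_on_proper_subsets U" and v: "v \<in> U" and ne: "nbrs U v \<noteq> {}"
  shows "real (card (containing U v)) \<le> growth ^ card U * (decay ^ (card (nbrs U v) + 1) *
    max (real (card (nbrs U v))) (1 + real (card (nbrs U v)) * decay))"
proof -
  let ?t = "growth ^ card U * decay ^ (card (nbrs U v) + 1)"
  have t: "?t \<ge> 0" using growth_pos decay_pos by simp
  show ?thesis
  proof (cases "\<exists>w\<in>nbrs U v. outer U v w = {}")
    case True
    then have "real (card (containing U v)) \<le> ?t * (\<Sum>w\<in>nbrs U v. decay ^ card (outer U v w))"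
      using card_containing_blocked_le[OF fin bd v] by blast
    also have "\<dots> \<le> ?t * max (real (card (nbrs U v))) (1 + real (card (nbrs U v)) * decay)"
      using sum_decay_outer_le[of U v] by (intro mult_left_mono[OF _ t]) auto
    finally show ?thesis by (simp add: mult.assoc)
  next
    case False
    then have "real (card (containing U v)) \<le> ?t * (1 + real (card (nbrs U v)) * decay)"
      using card_containing_open_le[OF fin bd v] by blast
    also have "\<dots> \<le> ?t * max (real (card (nbrs U v))) (1 + real (card (nbrs U v)) * decay)"
      by (intro mult_left_mono[OF _ t]) auto
    finally show ?thesis by (simp add: mult.assoc)
  qed
qed

text \<open>For degrees 0, 1 and 2 the factors are \<open>decay\<close>,
  \<open>decay ^ 2 + decay ^ 3\<close> and \<open>decay ^ 3 * max 2 (1 + 2 * decay)\<close>, roughly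
  0.63, 0.65 and 0.57; 2/3 is a common bound.\<close>

lemma card_containing_low_degree:
  assumes fin: "finite U" and bd: "bounded_on_proper_subsets U" and v: "v \<in> U" and deg: "card (nbrs U v) \<le> 2"
  shows "real (card (containing U v)) \<le> growth ^ card U * (2 / 3)"
proof -
  consider "card (nbrs U v) = 0" | "card (nbrs U v) = 1" | "card (nbrs U v) = 2"
    using deg by linarith
  then have "\<exists>x \<le> 2 / 3. real (card (containing U v)) \<le> growth ^ card U * x"
  proof cases
    case 1
    then have "nbrs U v = {}" using fin by simp
    then have "real (card (containing U v)) \<le> growth ^ card U * decay"
      using card_containing_le[OF fin bd v] card_isolating_le[OF fin bd v] by simp
    then show ?thesis using decay_less by (intro exI[of _ decay]) simp
  next
    case 2
    then have "nbrs U v \<noteq> {}" by auto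
    then have "real (card (containing U v)) \<le> growth ^ card U * (decay ^ 2 * (1 + decay))"
      using card_containing_le_max[OF fin bd v] 2 decay_pos by (simp add: numeral_2_eq_2)
    moreover have "decay ^ 2 * (1 + decay) = decay ^ 2 + decay ^ 3"
      by (simp add: power2_eq_square power3_eq_cube algebra_simps)
    ultimately show ?thesis using decay_power2_less decay_power3_less
      by (intro exI[of _ "decay ^ 2 * (1 + decay)"]) simp
  next
    case 3
    then have "nbrs U v \<noteq> {}" by auto
    then have "real (card (containing U v)) \<le> growth ^ card U * (decay ^ 3 * max 2 (1 + 2 * decay))"
      using card_containing_le_max[OF fin bd v] 3 by (simp add: numeral_3_eq_3)
    moreover have "decay ^ 3 * max 2 (1 + 2 * decay) \<le> decay ^ 3 * (23 / 10)"
      using decay_less decay_pos by (intro mult_left_mono) (simp_all add: max_def)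
    ultimately show ?thesis using decay_power3_less
      by (intro exI[of _ "decay ^ 3 * max 2 (1 + 2 * decay)"]) simp
  qed
  then show ?thesis
    using growth_pos by (meson mult_left_mono order_trans zero_le_power less_imp_le)
qed

text \<open>If \<open>v\<close> is isolated in \<open>F\<close>, the unique outer neighbour \<open>x\<close> of \<open>w\<close> must lie in \<open>F\<close>,
  and deleting the closed neighbourhood of \<open>v\<close> leaves \<open>x\<close> with degree at most 2.\<close>

lemma card_isolating_unique_outer:
  assumes fin: "finite U" and bd: "bounded_on_proper_subsets U" and v: "v \<in> U" and w: "w \<in> nbrs U v"
    and x: "outer U v w = {x}" and deg: "card (nbrs U x) \<le> 3"
  shows "real (card (isolating U v)) \<le> growth ^ card U * decay ^ (card (nbrs U v) + 1) * (2 / 3)"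
proof -
  let ?R = "cnbrs U v"
  let ?H = "U - ?R"
  have xH: "x \<in> ?H" and Exw: "E x w"
    using x sym by (auto simp: outer_def nbrs_def)
  have wR: "w \<in> ?R" and wU: "w \<in> U" using w by (auto simp: cnbrs_def nbrs_def)
  have "card (isolating U v) \<le> card (containing ?H x)"
  proof (rule card_inj_on_le[of "\<lambda>F. F - ?R"])
    show "inj_on (\<lambda>F. F - ?R) (isolating U v)"
      by (rule inj_onI) (auto simp: isolating_def cnbrs_def set_eq_iff)
    show "(\<lambda>F. F - ?R) ` isolating U v \<subseteq> containing ?H x"
    proof safe
      fix F assume F: "F \<in> isolating U v"
      then have "F \<inter> ?R = {v}" by (auto simp: isolating_def cnbrs_def)
      then have "F - ?R \<in> mds ?H"
        using F fin by (intro mds_Diff) (auto simp: isolating_def cnbrs_def nbrs_def)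
      moreover have "x \<in> F" using isolating_blocked[OF fin F w] x by auto
      ultimately show "F - ?R \<in> containing ?H x"
        using xH by (simp add: containing_def)
    qed
    show "finite (containing ?H x)" using fin by (simp add: containing_def)
  qed
  moreover have "nbrs ?H x \<subseteq> nbrs U x - {w}" "w \<in> nbrs U x"
    using wR wU Exw by (auto simp: nbrs_def)
  then have "card (nbrs ?H x) \<le> 2"
    using deg fin card_mono[of "nbrs U x - {w}" "nbrs ?H x"] by simp
  then have "real (card (containing ?H x)) \<le> growth ^ card ?H * (2 / 3)"
    using fin bd xH by (intro card_containing_low_degree) (auto intro: bounded_on_proper_subsets_subset)
  moreover have "growth ^ card ?H \<le> growth ^ card U * decay ^ (card (nbrs U v) + 1)"
    using fin cnbrs_subset[OF v] by (intro growth_Diff_le) (auto simp: card_cnbrs)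
  ultimately show ?thesis by linarith
qed

section \<open>Graphs of maximum degree at most three\<close>

text \<open>Lovasz's argument: moving a vertex with two neighbours on its own side of the cut
  decreases the number of uncut edges.\<close>

lemma subcubic_bipartition:
  assumes fin: "finite U" and deg: "\<And>v. v \<in> U \<Longrightarrow> card (nbrs U v) \<le> 3"
  obtains A where "A \<subseteq> U" "dissociation_set U E A" "dissociation_set U E (U - A)"
proof -
  \<comment> \<open>Ordered pairs are counted, so every edge inside a side contributes 2; hence the
    factors 2 below.\<close>
  define uncut where
    "uncut A = {(x, y). x \<in> U \<and> y \<in> U \<and> E x y \<and> (x \<in> A \<longleftrightarrow> y \<in> A)}" for A
  have fin_uncut: "finite (uncut A)" for A
    by (rule finite_subset[of _ "U \<times> U"]) (auto simp: uncut_def fin)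
  obtain A where AU: "A \<subseteq> U" and min: "\<And>B. B \<subseteq> U \<Longrightarrow> card (uncut A) \<le> card (uncut B)"
    using ex_has_least_nat[of "\<lambda>A. A \<subseteq> U" "{}" "\<lambda>A. card (uncut A)"] by auto
  have own_side: "y = z" if xU: "x \<in> U" and yz: "y \<in> U" "z \<in> U" "E x y" "E x z"
    and side: "y \<in> A \<longleftrightarrow> x \<in> A" "z \<in> A \<longleftrightarrow> x \<in> A" for x y z
  proof (rule ccontr)
    assume "y \<noteq> z"
    define own where "own = {y \<in> nbrs U x. y \<in> A \<longleftrightarrow> x \<in> A}"
    define other where "other = nbrs U x - own"
    \<comment> \<open>Pairs not involving \<open>x\<close> keep their status when \<open>x\<close>
      changes sides; at \<open>x\<close> itself, \<open>own\<close> and \<open>other\<close>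
      exchange roles.\<close>
    define rest where "rest = {(a, b) \<in> uncut A. a \<noteq> x \<and> b \<noteq> x}"
    define B where "B = (if x \<in> A then A - {x} else insert x A)"
    have B: "b \<in> B \<longleftrightarrow> (if b = x then x \<notin> A else b \<in> A)" for b
      by (auto simp: B_def)
    have finrest: "finite rest"
      using fin_uncut[of A] by (rule rev_finite_subset) (auto simp: rest_def)
    have star: "card (rest \<union> (Pair x ` N \<union> (\<lambda>y. (y, x)) ` N)) = card rest + 2 * card N"
      if N: "N \<subseteq> nbrs U x" for N
    proof -
      have finN: "finite N" using N fin finite_nbrs finite_subset by blast
      have xN: "x \<notin> N" using N by (auto simp: nbrs_def irrefl)
      have "card (Pair x ` N \<union> (\<lambda>y. (y, x)) ` N) = card (Pair x ` N) + card ((\<lambda>y. (y, x)) ` N)"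
        using finN xN by (intro card_Un_disjoint) auto
      also have "\<dots> = 2 * card N"
        by (simp add: card_image inj_on_def)
      finally show ?thesis
        using finN finrest by (subst card_Un_disjoint) (auto simp: rest_def)
    qed
    have "uncut A = rest \<union> (Pair x ` own \<union> (\<lambda>y. (y, x)) ` own)"
      using xU by (auto simp: uncut_def rest_def own_def nbrs_def irrefl image_iff dest: sym)
    then have cA: "card (uncut A) = card rest + 2 * card own"
      using star[of own] by (simp add: own_def)
    have "uncut B = rest \<union> (Pair x ` other \<union> (\<lambda>y. (y, x)) ` other)"
      using xU by (auto simp: uncut_def rest_def own_def other_def nbrs_def irrefl image_iff B
          dest: sym split: if_splits)
    then have cB: "card (uncut B) = card rest + 2 * card other"
      using star[of other] by (simp add: other_def)
    have "B \<subseteq> U" using AU xU by (auto simp: B_def)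
    then have "card own \<le> card other" using min[of B] cA cB by simp
    moreover have "card own + card other \<le> 3"
    proof -
      have "own \<union> other = nbrs U x" "own \<inter> other = {}" "finite own" "finite other"
        using fin by (auto simp: own_def other_def)
      then show ?thesis using deg[OF xU] card_Un_disjoint by metis
    qed
    \<comment> \<open>Minimality leaves at most one of the at most three neighbours on the side of
      \<open>x\<close>, but \<open>y\<close> and \<open>z\<close> are two of them.\<close>
    moreover have "card {y, z} \<le> card own"
      using yz side fin by (intro card_mono) (auto simp: own_def nbrs_def)
    ultimately show False using \<open>y \<noteq> z\<close> by simp
  qed
  show thesis
  proof
    show "A \<subseteq> U" by (rule AU)
    show "dissociation_set U E A"
      unfolding dissociation_iff[OF fin] using AU own_side by blast
    show "dissociation_set U E (U - A)"
      unfolding dissociation_iff[OF fin] using own_side by blast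
  qed
qed

text \<open>Both sides of the cut are dissociation sets, and the larger one has at least half of the
  vertices.\<close>

lemma subcubic_card_mds:
  assumes fin: "finite U" and deg: "\<And>v. v \<in> U \<Longrightarrow> card (nbrs U v) \<le> 3" and F: "F \<in> mds U"
  shows "card U \<le> 2 * card F"
proof -
  obtain A where A: "A \<subseteq> U" "dissociation_set U E A" "dissociation_set U E (U - A)"
    using subcubic_bipartition[OF fin deg] by blast
  have "card A \<le> card F" "card (U - A) \<le> card F"
    using A mds_card_ge[OF F] by auto
  moreover have "card U = card A + card (U - A)"
    using A(1) fin by (metis card_Diff_subset card_mono finite_subset le_add_diff_inverse)
  ultimately show ?thesis by simp
qed

lemma sum_card_mds:
  assumes "finite U"
  shows "(\<Sum>F\<in>mds U. card F) = (\<Sum>v\<in>U. card (containing U v))"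
proof -
  have "(\<Sum>F\<in>mds U. card {v \<in> U. v \<in> F}) = (\<Sum>v\<in>U. card (containing U v))"
    using assms by (intro sum_multicount_gen) (auto simp: containing_def)
  moreover have "{v \<in> U. v \<in> F} = F" if "F \<in> mds U" for F
    using mds_subset[OF that] by auto
  ultimately show ?thesis by simp
qed

text \<open>Pairs \<open>(v, F)\<close> with \<open>v \<in> F\<close> are counted in two ways: each
  \<open>F\<close> has at least \<open>card U / 2\<close> elements, while each \<open>v\<close> lies
  in fewer than \<open>growth ^ card U / 2\<close> sets.\<close>

lemma subcubic_averaging:
  assumes fin: "finite U" and ne: "U \<noteq> {}" and deg: "\<And>v. v \<in> U \<Longrightarrow> card (nbrs U v) \<le> 3"
    and half: "\<And>v. v \<in> U \<Longrightarrow> real (card (containing U v)) < growth ^ card U / 2"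
  shows "real (phi U) < growth ^ card U"
proof -
  have "card U * phi U = (\<Sum>F\<in>mds U. card U)"
    by (simp add: phi_eq)
  also have "\<dots> \<le> (\<Sum>F\<in>mds U. 2 * card F)"
    using subcubic_card_mds[OF fin deg] by (intro sum_mono)
  also have "\<dots> = 2 * (\<Sum>v\<in>U. card (containing U v))"
    by (simp add: sum_card_mds[OF fin, symmetric] sum_distrib_left)
  finally have "real (card U) * real (phi U) \<le> 2 * (\<Sum>v\<in>U. real (card (containing U v)))"
    by (metis of_nat_le_iff of_nat_mult of_nat_numeral of_nat_sum)
  also have "(\<Sum>v\<in>U. real (card (containing U v))) < (\<Sum>v\<in>U. growth ^ card U / 2)"
    by (rule sum_strict_mono[OF fin ne half])
  finally show ?thesis
    by (simp add: mult_less_cancel_left_disj)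
qed

text \<open>An isolated vertex can be added to any dissociation set, so every maximum set contains
  it, and deleting it gains a factor \<open>decay\<close>.\<close>

lemma phi_isolated_vertex:
  assumes fin: "finite U" and bd: "bounded_on_proper_subsets U" and v: "v \<in> U" and deg: "nbrs U v = {}"
  shows "real (phi U) < growth ^ card U"
proof -
  have "v \<in> F" if F: "F \<in> mds U" for F
  proof (rule ccontr)
    assume vF: "v \<notin> F"
    have FU: "F \<subseteq> U" using mds_subset[OF F] .
    have no: "\<not> E v y" "\<not> E y v" if "y \<in> insert v F" for y
      using deg FU that v sym by (auto simp: nbrs_def)
    have "y = z" if "x \<in> insert v F" "y \<in> insert v F" "z \<in> insert v F" "E x y" "E x z" for x y z
      using that no mds_matching[OF fin F] by (metis insertE)
    then have "dissociation_set U E (insert v F)"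
      using fin FU v by (subst dissociation_iff) blast+
    then show False using mds_not_insert[OF fin F vF] by blast
  qed
  then have "mds U = isolating U v"
    using deg by (auto simp: isolating_def)
  then have "real (phi U) \<le> growth ^ card U * decay"
    using card_isolating_le[OF fin bd v] deg by (simp add: phi_eq)
  also have "\<dots> < growth ^ card U * 1"
    using growth_pos decay_less by (intro mult_strict_left_mono) auto
  finally show ?thesis by simp
qed

text \<open>Adding \<open>v\<close> to \<open>F\<close> must give some vertex two neighbours: either
  \<open>v\<close> itself, or a neighbour \<open>y\<close> of \<open>v\<close> that already has a
  partner \<open>z\<close> in \<open>F\<close>.\<close>

lemma mds_avoiding_blocked:
  assumes fin: "finite U" and F: "F \<in> mds U" and v: "v \<in> U" "v \<notin> F"
  obtains (two) y z where "y \<in> F" "z \<in> F" "y \<noteq> z" "E v y" "E v z"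
    | (matched) y z where "y \<in> F" "z \<in> F" "E v y" "E y z"
proof -
  have FU: "F \<subseteq> U" using mds_subset[OF F] .
  obtain x y z where xyz: "x \<in> insert v F" "y \<in> insert v F" "z \<in> insert v F" "E x y" "E x z" "y \<noteq> z"
    using mds_not_insert[OF fin F v(2)] FU v(1) unfolding dissociation_iff[OF fin] by blast
  show thesis
  proof (cases "x = v")
    case True
    then show ?thesis using xyz irrefl two by blast
  next
    case False
    then have "x \<in> F" using xyz by blast
    then consider "y = v" "z \<in> F" | "z = v" "y \<in> F"
      using xyz mds_matching[OF fin F] by blast
    then show ?thesis using xyz \<open>x \<in> F\<close> sym matched by cases blast+
  qed
qed

text \<open>If the leaf \<open>v\<close> is omitted, then \<open>w\<close> is chosen and has a
  partner, for nothing else can block \<open>v\<close>; if \<open>v\<close> is chosen, it is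
  isolated or the partner of \<open>w\<close>. With \<open>d\<close> the degree of \<open>w\<close>,
  this gives the factor \<open>decay ^ 2 + d * decay ^ (d + 1)\<close>, below 1 for \<open>d\<close>
  from 1 to 3.\<close>

lemma phi_leaf:
  assumes fin: "finite U" and bd: "bounded_on_proper_subsets U" and v: "v \<in> U" and leaf: "nbrs U v = {w}"
    and deg: "card (nbrs U w) \<le> 3"
  shows "real (phi U) < growth ^ card U"
proof -
  let ?T = "growth ^ card U" and ?d = "card (nbrs U w)"
  let ?m = "\<lambda>u. {F \<in> mds U. w \<in> F \<and> u \<in> F}"
  have wU: "w \<in> U" and Evw: "E v w" using leaf by (auto simp: nbrs_def)
  have "mds U \<subseteq> isolating U v \<union> (\<Union>u\<in>nbrs U w. ?m u)"
  proof
    fix F assume F: "F \<in> mds U"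
    have FU: "F \<subseteq> U" using mds_subset[OF F] .
    show "F \<in> isolating U v \<union> (\<Union>u\<in>nbrs U w. ?m u)"
    proof (cases "v \<in> F")
      case True
      then show ?thesis using F leaf v sym[OF Evw] by (auto simp: isolating_def nbrs_def)
    next
      case False
      have only: "y = w" if "y \<in> F" "E v y" for y
        using that leaf FU by (auto simp: nbrs_def)
      from fin F v False have "\<exists>u\<in>F. w \<in> F \<and> E w u"
        by (cases rule: mds_avoiding_blocked) (use only in blast)+
      then show ?thesis using F FU by (auto simp: nbrs_def)
    qed
  qed
  then have "card (mds U) \<le> card (isolating U v \<union> (\<Union>u\<in>nbrs U w. ?m u))"
    using fin by (intro card_mono) (auto simp: isolating_def)
  also have "\<dots> \<le> card (isolating U v) + (\<Sum>u\<in>nbrs U w. card (?m u))"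
    using card_Un_le[of "isolating U v" "\<Union>u\<in>nbrs U w. ?m u"]
      card_UN_le[of "nbrs U w" ?m] fin by simp
  finally have 1: "real (phi U) \<le> real (card (isolating U v)) + (\<Sum>u\<in>nbrs U w. real (card (?m u)))"
    by (simp add: phi_eq flip: of_nat_sum of_nat_add)
  have "real (card (?m u)) \<le> ?T * decay ^ (?d + 1)" if "u \<in> nbrs U w" for u
  proof -
    have "real (card (?m u)) \<le> ?T * decay ^ (?d + 1 + card (outer U w u))"
      using card_matched_le[OF fin bd wU that] .
    also have "\<dots> \<le> ?T * decay ^ (?d + 1)"
      using growth_pos by (intro mult_left_mono decay_power_antimono) auto
    finally show ?thesis .
  qed
  then have "(\<Sum>u\<in>nbrs U w. real (card (?m u))) \<le> real ?d * (?T * decay ^ (?d + 1))"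
    using sum_bounded_above[of "nbrs U w" "\<lambda>u. real (card (?m u))"] by simp
  moreover have "real (card (isolating U v)) \<le> ?T * decay ^ 2"
    using card_isolating_le[OF fin bd v] leaf by (simp add: numeral_2_eq_2)
  ultimately have 2: "real (phi U) \<le> ?T * (decay ^ 2 + real ?d * decay ^ (?d + 1))"
    using 1 by (simp add: algebra_simps)
  have "?d \<noteq> 0" using v Evw sym fin by (auto simp: nbrs_def)
  then consider "?d = 1" | "?d = 2" | "?d = 3" using deg by linarith
  then have "decay ^ 2 + real ?d * decay ^ (?d + 1) < 1"
    using decay_power2_less decay_power3_less decay_power4_less
    by cases (simp_all add: numeral_eq_Suc)
  then have "?T * (decay ^ 2 + real ?d * decay ^ (?d + 1)) < ?T * 1"
    using growth_pos by (intro mult_strict_left_mono) auto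
  then show ?thesis using 2 by simp
qed

text \<open>The component of \<open>v\<close> is a triangle, and every maximum set contains two of
  its vertices. Each of the three choices removes the whole triangle, and
  \<open>3 * decay ^ 3 < 1\<close>.\<close>

lemma phi_triangle:
  assumes fin: "finite U" and bd: "bounded_on_proper_subsets U" and v: "v \<in> U"
    and nv: "nbrs U v = {a, b}" and na: "nbrs U a = {v, b}" and nb: "nbrs U b = {v, a}"
    and ab: "a \<noteq> b"
  shows "real (phi U) < growth ^ card U"
proof -
  let ?T = "growth ^ card U"
  let ?m = "\<lambda>x y. {F \<in> mds U. x \<in> F \<and> y \<in> F}"
  have U: "a \<in> U" "b \<in> U" and E: "E v a" "E v b"
    using nv by (auto simp: nbrs_def)
  have ne: "v \<noteq> a" "v \<noteq> b" using E irrefl by auto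
  have "mds U \<subseteq> ?m v a \<union> (?m v b \<union> ?m a b)"
  proof
    fix F assume F: "F \<in> mds U"
    have FU: "F \<subseteq> U" using mds_subset[OF F] .
    have only: "y \<in> {a, b}" if "y \<in> F" "E v y" for y
      using that nv FU by (auto simp: nbrs_def)
    have onlya: "y \<in> {v, b}" if "y \<in> F" "E a y" for y
      using that na FU by (auto simp: nbrs_def)
    have onlyb: "y \<in> {v, a}" if "y \<in> F" "E b y" for y
      using that nb FU by (auto simp: nbrs_def)
    show "F \<in> ?m v a \<union> (?m v b \<union> ?m a b)"
    proof (cases "v \<in> F")
      case True
      \<comment> \<open>All neighbours of \<open>a\<close> lie in the closed neighbourhood of
        \<open>v\<close>, so \<open>v\<close> is never isolated in a maximum set.\<close>
      have "outer U v a = {}" using na nv by (auto simp: outer_def cnbrs_def)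
      then have "F \<notin> isolating U v" using isolating_empty[OF fin, of a v] nv by simp
      then have "a \<in> F \<or> b \<in> F" using True F nv by (auto simp: isolating_def)
      then show ?thesis using True F by auto
    next
      case False
      from fin F v False have "a \<in> F \<and> b \<in> F"
      proof (cases rule: mds_avoiding_blocked)
        case (two y z)
        then show ?thesis using only by blast
      next
        case (matched y z)
        then have "y \<in> {a, b}" using only by blast
        then show ?thesis using matched onlya onlyb False by blast
      qed
      then show ?thesis using F by auto
    qed
  qed
  then have "card (mds U) \<le> card (?m v a \<union> (?m v b \<union> ?m a b))"
    using fin by (intro card_mono) auto
  also have "\<dots> \<le> card (?m v a) + (card (?m v b) + card (?m a b))"
    using card_Un_le[of "?m v a" "?m v b \<union> ?m a b"] card_Un_le[of "?m v b" "?m a b"] by linarith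
  finally have "real (phi U) \<le> real (card (?m v a)) + (real (card (?m v b)) + real (card (?m a b)))"
    by (simp add: phi_eq flip: of_nat_add)
  moreover have "real (card (?m x y)) \<le> ?T * decay ^ 3"
    if x: "x \<in> U" and y: "y \<in> nbrs U x" and c: "card (nbrs U x) = 2" for x y
  proof -
    have "real (card (?m x y)) \<le> ?T * decay ^ (card (nbrs U x) + 1 + card (outer U x y))"
      using card_matched_le[OF fin bd x y] .
    also have "\<dots> \<le> ?T * decay ^ 3"
      using growth_pos c by (intro mult_left_mono decay_power_antimono) auto
    finally show ?thesis .
  qed
  from this[of v a] this[of v b] this[of a b]
  have "real (card (?m v a)) \<le> ?T * decay ^ 3" "real (card (?m v b)) \<le> ?T * decay ^ 3"
    "real (card (?m a b)) \<le> ?T * decay ^ 3"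
    using v U nv na ab ne by simp_all
  ultimately have "real (phi U) \<le> ?T * (3 * decay ^ 3)" by simp
  also have "\<dots> < ?T * 1"
    using growth_pos decay_power3_less by (intro mult_strict_left_mono) auto
  finally show ?thesis by simp
qed

text \<open>In units of \<open>growth ^ card U * decay ^ 3\<close> the count is at most
  \<open>i + s\<close>, with \<open>i\<close> for the isolated class and \<open>s\<close> for the
  two matched ones. Without any outer neighbours \<open>s\<close> would be 2, and
  \<open>2 * decay ^ 3\<close>, about 0.502, slightly misses the target; \<open>out\<close> excludes
  this.\<close>

lemma card_containing_degree2:
  assumes fin: "finite U" and bd: "bounded_on_proper_subsets U" and v: "v \<in> U"
    and nv: "nbrs U v = {a, b}" and ab: "a \<noteq> b"
    and out: "outer U v a \<noteq> {} \<or> outer U v b \<noteq> {}"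
    and deg: "\<And>u. u \<in> U \<Longrightarrow> card (nbrs U u) \<le> 3"
  shows "real (card (containing U v)) < growth ^ card U / 2"
proof -
  let ?T = "growth ^ card U"
  have T: "?T > 0" using growth_pos by simp
  have d: "card (nbrs U v) = 2" using nv ab by simp
  have d1: "decay ^ card (outer U v w) \<le> decay" if "outer U v w \<noteq> {}" for w
    using decay_power_antimono[of 1 "card (outer U v w)"] that fin
    by (simp add: Suc_le_eq card_gt_0_iff)
  have decay0: "decay ^ card (outer U v w) \<le> 1" for w
    using decay_le_1 decay_pos by (simp add: power_le_one)
  have sum: "(\<Sum>w\<in>nbrs U v. decay ^ card (outer U v w)) =
      decay ^ card (outer U v a) + decay ^ card (outer U v b)"
    using nv ab by simp
  have le: "real (card (containing U v)) \<le> real (card (isolating U v))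
      + ?T * decay ^ 3 * (decay ^ card (outer U v a) + decay ^ card (outer U v b))"
    using card_containing_le[OF fin bd v] unfolding sum d by (simp add: numeral_3_eq_3)
  have p4: "decay ^ 3 * decay = decay ^ 4" and p5: "decay ^ 3 * decay\<^sup>2 = 1 / 10"
    using decay_power5 by (simp_all flip: power_add power_Suc2)
  have bound: "real (card (containing U v)) \<le> ?T * (decay ^ 3 * (i + s))"
    if "real (card (isolating U v)) \<le> ?T * decay ^ 3 * i"
      and "decay ^ card (outer U v a) + decay ^ card (outer U v b) \<le> s" for i s
  proof -
    have "?T * decay ^ 3 * (decay ^ card (outer U v a) + decay ^ card (outer U v b)) \<le> ?T * decay ^ 3 * s"
      using that(2) growth_pos decay_pos by (intro mult_left_mono) auto
    then have "real (card (containing U v)) \<le> ?T * decay ^ 3 * i + ?T * decay ^ 3 * s"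
      using le that(1) by linarith
    then show ?thesis by (simp add: algebra_simps)
  qed
  have "\<exists>x < 1 / 2. real (card (containing U v)) \<le> ?T * x"
  proof (cases "outer U v a = {} \<or> outer U v b = {}")
    case True
    \<comment> \<open>Here \<open>i = 0\<close>, and the nonempty outer set lowers \<open>s\<close>
      to \<open>1 + decay\<close>.\<close>
    then have "isolating U v = {}" using isolating_empty[OF fin] nv by blast
    moreover have "decay ^ card (outer U v a) + decay ^ card (outer U v b) \<le> 1 + decay"
      using out
    proof
      assume "outer U v a \<noteq> {}"
      then show ?thesis using d1[of a] decay0[of b] by simp
    next
      assume "outer U v b \<noteq> {}"
      then show ?thesis using d1[of b] decay0[of a] by simp
    qed
    ultimately have "real (card (containing U v)) \<le> ?T * (decay ^ 3 * (0 + (1 + decay)))"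
      by (intro bound) simp_all
    moreover have "decay ^ 3 * (0 + (1 + decay)) < 1 / 2"
      using decay_power3_less decay_power4_less p4 by (simp add: distrib_left)
    ultimately show ?thesis by blast
  next
    case False
    then have ne: "outer U v w \<noteq> {}" if "w \<in> nbrs U v" for w using that nv by auto
    show ?thesis
    \<comment> \<open>The values \<open>i = 1\<close> and \<open>s = 2 * decay\<close> together are
      too large. A unique outer neighbour improves \<open>i\<close> to 2/3; at least two outer
      neighbours for both \<open>a\<close> and \<open>b\<close> improve \<open>s\<close> to
      \<open>2 * decay ^ 2\<close>.\<close>
    proof (cases "\<exists>w\<in>nbrs U v. card (outer U v w) = 1")
      case True
      then obtain w x where w: "w \<in> nbrs U v" "outer U v w = {x}"
        by (metis card_1_singletonE)
      then have "x \<in> U" by (auto simp: outer_def nbrs_def)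
      then have "real (card (isolating U v)) \<le> ?T * decay ^ 3 * (2 / 3)"
        using card_isolating_unique_outer[OF fin bd v w deg] d by (simp add: numeral_3_eq_3)
      moreover have "decay ^ card (outer U v a) + decay ^ card (outer U v b) \<le> decay + decay"
        using ne nv by (intro add_mono d1) auto
      ultimately have "real (card (containing U v)) \<le> ?T * (decay ^ 3 * (2 / 3 + (decay + decay)))"
        by (rule bound)
      moreover have "decay ^ 3 * (2 / 3 + (decay + decay)) < 1 / 2"
        using decay_power3_less decay_power4_less unfolding distrib_left p4 by simp
      ultimately show ?thesis by blast
    next
      case False
      have "2 \<le> card (outer U v w)" if w: "w \<in> nbrs U v" for w
      proof -
        have "card (outer U v w) \<noteq> 0" "card (outer U v w) \<noteq> 1"
          using ne[OF w] False w fin by auto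
        then show ?thesis by linarith
      qed
      then have "decay ^ card (outer U v a) + decay ^ card (outer U v b) \<le> decay\<^sup>2 + decay\<^sup>2"
        using nv by (intro add_mono decay_power_antimono) auto
      moreover have "real (card (isolating U v)) \<le> ?T * decay ^ 3 * 1"
        using card_isolating_le[OF fin bd v] d by (simp add: numeral_3_eq_3)
      ultimately have "real (card (containing U v)) \<le> ?T * (decay ^ 3 * (1 + (decay\<^sup>2 + decay\<^sup>2)))"
        by (intro bound)
      moreover have "decay ^ 3 * (1 + (decay\<^sup>2 + decay\<^sup>2)) < 1 / 2"
        using decay_power3_less unfolding distrib_left p5 by simp
      ultimately show ?thesis by blast
    qed
  qed
  then obtain x where "x < 1 / 2" "real (card (containing U v)) \<le> ?T * x" by blast
  moreover from this have "?T * x < ?T * (1 / 2)" using T by (intro mult_strict_left_mono)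
  ultimately show ?thesis by simp
qed

text \<open>As \<open>1 + 3 * decay\<close> stays below 3, the matched classes dominate, and
  \<open>3 * decay ^ 4\<close> is about 0.475.\<close>

lemma card_containing_degree3:
  assumes fin: "finite U" and bd: "bounded_on_proper_subsets U" and v: "v \<in> U" and d: "card (nbrs U v) = 3"
  shows "real (card (containing U v)) < growth ^ card U / 2"
proof -
  have "nbrs U v \<noteq> {}" using d by auto
  then have "real (card (containing U v)) \<le> growth ^ card U * (decay ^ 4 * max 3 (1 + 3 * decay))"
    using card_containing_le_max[OF fin bd v] d by simp
  also have "max 3 (1 + 3 * decay) = 3" using decay_less by simp
  also have "growth ^ card U * (decay ^ 4 * 3) < growth ^ card U * (1 / 2)"
    using growth_pos decay_power4_less by (intro mult_strict_left_mono) auto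
  finally show ?thesis by simp
qed

text \<open>Degrees 0 and 1 are settled directly. If all degrees are 2 or 3 and no component is a
  triangle, every vertex lies in few enough sets for the averaging argument.\<close>

lemma phi_subcubic:
  assumes fin: "finite U" and bd: "bounded_on_proper_subsets U" and ne: "U \<noteq> {}"
    and deg: "\<And>v. v \<in> U \<Longrightarrow> card (nbrs U v) \<le> 3"
  shows "real (phi U) < growth ^ card U"
proof (cases "\<exists>v\<in>U. card (nbrs U v) \<le> 1")
  case True
  then obtain v where v: "v \<in> U" "card (nbrs U v) = 0 \<or> card (nbrs U v) = 1" by force
  from v(2) show ?thesis
  proof
    assume "card (nbrs U v) = 0"
    then show ?thesis using phi_isolated_vertex[OF fin bd v(1)] fin by simp
  next
    assume "card (nbrs U v) = 1"
    then obtain w where w: "nbrs U v = {w}" by (metis card_1_singletonE)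
    then have "w \<in> U" by (auto simp: nbrs_def)
    then show ?thesis using phi_leaf[OF fin bd v(1) w] deg by blast
  qed
next
  case False
  then have ge2: "2 \<le> card (nbrs U u)" if "u \<in> U" for u using that by force
  show ?thesis
  proof (rule ccontr)
    assume large: "\<not> ?thesis"
    have "real (card (containing U v)) < growth ^ card U / 2" if v: "v \<in> U" for v
    proof (cases "card (nbrs U v) = 3")
      case True
      then show ?thesis using card_containing_degree3[OF fin bd v] by blast
    next
      case False
      then have "card (nbrs U v) = 2" using deg[OF v] ge2[OF v] by linarith
      then obtain a b where nv: "nbrs U v = {a, b}" and ab: "a \<noteq> b" by (meson card_2_iff)
      have U: "a \<in> U" "b \<in> U" and E: "E v a" "E v b" using nv by (auto simp: nbrs_def)
      \<comment> \<open>With minimum degree 2, two empty outer sets would make \<open>v\<close>,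
        \<open>a\<close>, \<open>b\<close> a triangle component, where \<open>phi_triangle\<close>
        is already strict.\<close>
      have "outer U v a \<noteq> {} \<or> outer U v b \<noteq> {}"
      proof (rule ccontr)
        assume "\<not> ?thesis"
        then have sub: "nbrs U a \<subseteq> {v, b}" "nbrs U b \<subseteq> {v, a}"
          using nv irrefl by (auto simp: outer_def cnbrs_def nbrs_def)
        have "v \<noteq> a" "v \<noteq> b" using E irrefl by auto
        then have "nbrs U a = {v, b}" "nbrs U b = {v, a}"
          using card_seteq[OF _ sub(1)] card_seteq[OF _ sub(2)] ge2[OF U(1)] ge2[OF U(2)]
          by (simp_all add: numeral_2_eq_2)
        then show False using phi_triangle[OF fin bd v nv _ _ ab] large by blast
      qed
      then show ?thesis using card_containing_degree2[OF fin bd v nv ab] deg by blast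
    qed
    then show False using subcubic_averaging[OF fin ne deg] large by blast
  qed
qed

section \<open>Vertices of degree at least four\<close>

lemma phi_le_containing:
  assumes fin: "finite U" and bd: "bounded_on_proper_subsets U" and v: "v \<in> U"
  shows "real (phi U) \<le> growth ^ card U * decay + real (card (containing U v))"
proof -
  have "mds U = {F \<in> mds U. v \<notin> F} \<union> containing U v"
    by (auto simp: containing_def)
  then have "phi U \<le> card {F \<in> mds U. v \<notin> F} + card (containing U v)"
    unfolding phi_eq by (metis card_Un_le)
  then show ?thesis using card_avoiding_le[OF fin bd v] by linarith
qed

text \<open>The sets avoiding \<open>v\<close> contribute a factor at most \<open>decay\<close>,
  those through \<open>v\<close> at most \<open>d * decay ^ (d + 1) \<le> decay / 2\<close> for
  degree \<open>d\<close>; together this is about 0.95.\<close>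

lemma phi_degree_ge5:
  assumes fin: "finite U" and bd: "bounded_on_proper_subsets U" and v: "v \<in> U" and d: "5 \<le> card (nbrs U v)"
  shows "real (phi U) < growth ^ card U"
proof -
  let ?T = "growth ^ card U" and ?d = "card (nbrs U v)"
  have "nbrs U v \<noteq> {}" using d by auto
  then have "real (card (containing U v)) \<le> ?T * (decay ^ (?d + 1) * max (real ?d) (1 + real ?d * decay))"
    using card_containing_le_max[OF fin bd v] by simp
  also have "max (real ?d) (1 + real ?d * decay) = real ?d"
  proof -
    have "real ?d * decay \<le> real ?d * (632 / 1000)"
      using decay_less by (intro mult_left_mono) auto
    then have "1 + real ?d * decay \<le> real ?d" using d by linarith
    then show ?thesis by (rule max_absorb1)
  qed
  also have "?T * (decay ^ (?d + 1) * real ?d) \<le> ?T * (decay / 2)"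
    using linear_decay_le[OF d] growth_pos by (intro mult_left_mono) (auto simp: mult.commute)
  finally have "real (phi U) \<le> ?T * (3 / 2 * decay)"
    using phi_le_containing[OF fin bd v] by simp
  also have "\<dots> < ?T * 1"
    using growth_pos decay_less by (intro mult_strict_left_mono) auto
  finally show ?thesis by simp
qed

text \<open>Since \<open>decay ^ 5 = 1 / 10\<close>, four matched classes at full weight would give
  \<open>decay + 4 / 10\<close>, which exceeds 1. One outer neighbour replaces a tenth by
  \<open>decay / 10\<close>, and the total \<open>3 / 10 + 11 / 10 * decay\<close> falls just below
  1.\<close>

lemma phi_degree4_open:
  assumes fin: "finite U" and bd: "bounded_on_proper_subsets U" and v: "v \<in> U" and d: "card (nbrs U v) = 4"
    and u: "u \<in> nbrs U v" "outer U v u \<noteq> {}"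
  shows "real (phi U) < growth ^ card U"
proof -
  let ?T = "growth ^ card U"
  have T: "?T > 0" using growth_pos by simp
  have "real (card (containing U v)) \<le> ?T * (1 / 10 * (3 + decay))"
  proof (cases "\<exists>w\<in>nbrs U v. outer U v w = {}")
    case True
    have "(\<Sum>w\<in>nbrs U v. decay ^ card (outer U v w)) =
        decay ^ card (outer U v u) + (\<Sum>w\<in>nbrs U v - {u}. decay ^ card (outer U v w))"
      using u fin by (simp add: sum.remove)
    also have "\<dots> \<le> decay + 3"
    proof (rule add_mono)
      show "decay ^ card (outer U v u) \<le> decay"
        using decay_power_antimono[of 1 "card (outer U v u)"] u fin
        by (simp add: Suc_le_eq card_gt_0_iff)
      have "(\<Sum>w\<in>nbrs U v - {u}. decay ^ card (outer U v w)) \<le> real (card (nbrs U v - {u})) * 1"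
        using decay_le_1 decay_pos by (intro sum_bounded_above) (simp add: power_le_one)
      then show "(\<Sum>w\<in>nbrs U v - {u}. decay ^ card (outer U v w)) \<le> 3"
        using u d fin by simp
    qed
    finally have "?T * decay ^ 5 * (\<Sum>w\<in>nbrs U v. decay ^ card (outer U v w)) \<le> ?T * decay ^ 5 * (decay + 3)"
      using T decay_pos by (intro mult_left_mono) auto
    moreover have "real (card (containing U v)) \<le> ?T * decay ^ 5 * (\<Sum>w\<in>nbrs U v. decay ^ card (outer U v w))"
      using True card_containing_blocked_le[OF fin bd v] d by auto
    ultimately show ?thesis by (simp add: decay_power5 algebra_simps)
  next
    case False
    then have "real (card (containing U v)) \<le> ?T * (1 / 10 * (1 + 4 * decay))"
      using card_containing_open_le[OF fin bd v] d decay_power5 by simp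
    also have "\<dots> \<le> ?T * (1 / 10 * (3 + decay))"
      using T decay_less by (intro mult_left_mono) auto
    finally show ?thesis .
  qed
  then have "real (phi U) \<le> ?T * (3 / 10 + 11 / 10 * decay)"
    using phi_le_containing[OF fin bd v] by (simp add: algebra_simps)
  also have "\<dots> < ?T * 1"
    using T decay_less by (intro mult_strict_left_mono) auto
  finally show ?thesis by simp
qed

section \<open>The extremal components on five vertices\<close>

text \<open>The complement within \<open>C\<close> has maximum degree at most 1: an intrinsic form
  of a complete graph on five vertices minus a matching, free of a chosen isomorphism.\<close>

definition near_clique :: "'a set \<Rightarrow> bool" where
  "near_clique C \<longleftrightarrow> card C = 5 \<and>
    (\<forall>x\<in>C. \<forall>y\<in>C. \<forall>z\<in>C. y \<noteq> x \<and> z \<noteq> x \<and> \<not> E x y \<and> \<not> E x z \<longrightarrow> y = z)"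

text \<open>Any bijection onto \<open>{0..<5}\<close> carries the non-adjacent pairs to a set
  \<open>M\<close>; uniqueness of non-neighbours corresponds to \<open>M\<close> being a
  matching.\<close>

lemma near_clique_iff_induced_iso: "near_clique C \<longleftrightarrow> induced_iso_K5_minus_matching E C"
proof
  assume C: "near_clique C"
  then have "finite C" by (auto simp: near_clique_def intro: card_ge_0_finite)
  then obtain f where f: "bij_betw f C {0..<5::nat}"
    using ex_bij_betw_finite_nat[of C] C by (auto simp: near_clique_def)
  then have inj: "f x = f y \<longleftrightarrow> x = y" if "x \<in> C" "y \<in> C" for x y
    using that by (auto simp: bij_betw_def inj_on_def)
  have f5: "f x < 5" if "x \<in> C" for x
    using f that by (auto dest: bij_betwE)
  define M where "M = {{f x, f y} | x y. x \<in> C \<and> y \<in> C \<and> x \<noteq> y \<and> \<not> E x y}"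
  have M2: "e \<subseteq> {0..<5} \<and> card e = 2" if "e \<in> M" for e
    using that inj f5 by (auto simp: M_def)
  have unique: "y = z" if "x \<in> C" "y \<in> C" "z \<in> C" "y \<noteq> x" "z \<noteq> x" "\<not> E x y" "\<not> E x z" for x y z
    using C that unfolding near_clique_def by blast
  have star: "e = {f x, f y}" if e: "e \<in> M" "f x \<in> e" and xy: "x \<in> C" "y \<in> C" "x \<noteq> y" "\<not> E x y" for e x y
  proof -
    obtain a b where ab: "e = {f a, f b}" "a \<in> C" "b \<in> C" "a \<noteq> b" "\<not> E a b"
      using e(1) unfolding M_def by blast
    have ba: "\<not> E b a" using ab(5) sym by blast
    have "x = a \<or> x = b" using ab e(2) inj xy by auto
    then show ?thesis
    proof
      assume "x = a"
      then have "b = y" using unique[of x b y] ab xy by blast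
      then show ?thesis using ab(1) \<open>x = a\<close> by simp
    next
      assume "x = b"
      then have "a = y" using unique[of x a y] ab ba xy by blast
      then show ?thesis using ab(1) \<open>x = b\<close> by (simp add: insert_commute)
    qed
  qed
  have disj: "e \<inter> e' = {}" if e: "e \<in> M" "e' \<in> M" "e \<noteq> e'" for e e'
  proof (rule ccontr)
    assume "e \<inter> e' \<noteq> {}"
    moreover obtain x y where xy: "x \<in> C" "y \<in> C" "x \<noteq> y" "\<not> E x y" "e = {f x, f y}"
      using e(1) unfolding M_def by blast
    ultimately have "f x \<in> e' \<or> f y \<in> e'" by blast
    moreover have "\<not> E y x" using xy(4) sym by blast
    ultimately have "e' = {f x, f y} \<or> e' = {f y, f x}"
      using star[OF e(2), of x y] star[OF e(2), of y x] xy by blast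
    then show False using e(3) xy(5) by blast
  qed
  \<comment> \<open>The members of \<open>M\<close> are disjoint pairs in a set of five elements, so
    \<open>2 * card M \<le> 5\<close>.\<close>
  have "2 * card M = sum card M" using M2 by simp
  also have "\<dots> = card (\<Union>M)"
    using disj M2 by (intro card_Union_disjoint[symmetric])
      (auto simp: pairwise_def disjnt_def intro: card_ge_0_finite)
  also have "\<dots> \<le> card {0..<5::nat}"
    using M2 by (intro card_mono) auto
  finally have "card M \<le> 2" by simp
  moreover have "E x y \<longleftrightarrow> K5_minus M (f x) (f y)" if "x \<in> C" "y \<in> C" for x y
  proof -
    have "{f x, f y} \<in> M \<longleftrightarrow> x \<noteq> y \<and> \<not> E x y"
    proof
      assume "{f x, f y} \<in> M"
      then obtain a b where ab: "{f x, f y} = {f a, f b}" "a \<in> C" "b \<in> C" "a \<noteq> b" "\<not> E a b"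
        unfolding M_def by blast
      then have "x = a \<and> y = b \<or> x = b \<and> y = a"
        using inj that by (auto simp: doubleton_eq_iff)
      then show "x \<noteq> y \<and> \<not> E x y" using ab sym by blast
    qed (use that in \<open>unfold M_def, blast\<close>)
    then show ?thesis
      using that inj f5 irrefl by (auto simp: K5_minus_def)
  qed
  moreover have "is_matching_K5 M"
    unfolding is_matching_K5_def using M2 disj by blast
  ultimately show "induced_iso_K5_minus_matching E C"
    unfolding induced_iso_K5_minus_matching_def
    using f by (intro exI[of _ M] exI[of _ f]) blast
next
  assume "induced_iso_K5_minus_matching E C"
  then obtain M f where M: "is_matching_K5 M" and f: "bij_betw f C {0..<5}"
    and E: "\<And>x y. x \<in> C \<Longrightarrow> y \<in> C \<Longrightarrow> E x y \<longleftrightarrow> K5_minus M (f x) (f y)"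
    unfolding induced_iso_K5_minus_matching_def by blast
  have inj: "f x = f y \<longleftrightarrow> x = y" if "x \<in> C" "y \<in> C" for x y
    using f that by (auto simp: bij_betw_def inj_on_def)
  have f5: "f x < 5" if "x \<in> C" for x
    using f that by (auto dest: bij_betwE)
  have "y = z" if "x \<in> C" "y \<in> C" "z \<in> C" "y \<noteq> x" "z \<noteq> x" "\<not> E x y" "\<not> E x z" for x y z
  proof -
    have "{f x, f y} \<in> M" "{f x, f z} \<in> M"
      using E[of x y] E[of x z] that f5[of x] f5[of y] f5[of z] inj[of x y] inj[of x z]
      by (auto simp: K5_minus_def)
    moreover have "{f x, f y} \<inter> {f x, f z} \<noteq> {}" by blast
    ultimately have "{f x, f y} = {f x, f z}"
      using M unfolding is_matching_K5_def by meson
    then have "f y = f z" by (auto simp: doubleton_eq_iff)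
    then show ?thesis using inj that by blast
  qed
  then show "near_clique C"
    unfolding near_clique_def using bij_betw_same_card[OF f] by (intro conjI) (simp, blast)
qed

lemma dissociation_pair:
  assumes "finite C" "F \<subseteq> C" "card F = 2"
  shows "dissociation_set C E F"
  using assms irrefl by (subst dissociation_iff) (auto simp: card_2_iff)

text \<open>Every pair of vertices is a dissociation set, so the maximum sets are exactly the
  \<open>5 choose 2\<close> pairs.\<close>

lemma phi_eq_10_if_card_le_2:
  assumes C: "card C = 5" and le2: "\<And>F. dissociation_set C E F \<Longrightarrow> card F \<le> 2"
  shows "phi C = 10"
proof -
  have fin: "finite C" using C by (auto intro: card_ge_0_finite)
  obtain S where S: "S \<subseteq> C" "card S = 2"
    using obtain_subset_with_card_n[of 2 C] C by auto
  have "mds C = {F. F \<subseteq> C \<and> card F = 2}"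
  proof (intro set_eqI iffI)
    fix F assume F: "F \<in> mds C"
    then have "card F \<le> 2" using le2 mds_dissociation by blast
    moreover have "card S \<le> card F"
      using mds_card_ge[OF F] dissociation_pair[OF fin S] by blast
    ultimately show "F \<in> {F. F \<subseteq> C \<and> card F = 2}" using S mds_subset[OF F] by simp
  next
    fix F assume "F \<in> {F. F \<subseteq> C \<and> card F = 2}"
    then show "F \<in> mds C"
      using le2 dissociation_pair[OF fin] by (simp add: mds_def max_dissociation_set_def)
  qed
  then have "phi C = 5 choose 2" using n_subsets[OF fin, of 2] C by (simp add: phi_eq)
  then show ?thesis by (simp add: numeral_eq_Suc)
qed

text \<open>Of three vertices in a dissociation set, each would be adjacent to at least one of the
  other two, having at most one non-neighbour, and to at most one. Three vertices cannot be
  perfectly matched.\<close>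

lemma phi_near_clique:
  assumes "near_clique C"
  shows "phi C = 10"
proof (rule phi_eq_10_if_card_le_2)
  show card5: "card C = 5" using assms by (simp add: near_clique_def)
  then have fin: "finite C" by (auto intro: card_ge_0_finite)
  fix F assume F: "dissociation_set C E F"
  show "card F \<le> 2"
  proof (rule ccontr)
    assume "\<not> card F \<le> 2"
    then obtain S where "S \<subseteq> F" "card S = 3"
      using obtain_subset_with_card_n[of 3 F] by auto
    then obtain x y z where xyz: "{x, y, z} \<subseteq> F" "x \<noteq> y" "y \<noteq> z" "x \<noteq> z"
      by (auto simp: card_3_iff)
    have "F \<subseteq> C" and m: "\<And>x y z. x \<in> F \<Longrightarrow> y \<in> F \<Longrightarrow> z \<in> F \<Longrightarrow> E x y \<Longrightarrow> E x z \<Longrightarrow> y = z"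
      using F by (auto simp: dissociation_iff[OF fin])
    then have in_C: "x \<in> C" "y \<in> C" "z \<in> C" using xyz by auto
    have un: "\<And>x y z. x \<in> C \<Longrightarrow> y \<in> C \<Longrightarrow> z \<in> C \<Longrightarrow> y \<noteq> x \<Longrightarrow> z \<noteq> x \<Longrightarrow> \<not> E x y \<Longrightarrow> \<not> E x z \<Longrightarrow> y = z"
      using assms unfolding near_clique_def by blast
    have "E x y \<or> E x z" "E y x \<or> E y z" "E z x \<or> E z y"
      using un[of x y z] un[of y x z] un[of z x y] in_C xyz by auto
    moreover have "\<not> (E x y \<and> E x z)" "\<not> (E y x \<and> E y z)" "\<not> (E z x \<and> E z y)"
      using m[of x y z] m[of y x z] m[of z x y] xyz by auto
    ultimately show False
      using sym[of x y] sym[of y x] sym[of x z] sym[of z x] sym[of y z] sym[of z y] by blast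
  qed
qed

text \<open>If some dissociation set has three elements, the dominating vertex \<open>v\<close> lies
  in no maximum set, and \<open>phi C \<le> 10 * decay\<close>. Otherwise no vertex has two
  non-neighbours, as the three together would form a dissociation set.\<close>

lemma phi_five_dominated:
  assumes C: "card C = 5" and bd: "bounded_on_proper_subsets C" and v: "v \<in> C" and nv: "nbrs C v = C - {v}"
  shows "phi C \<le> 10 \<and> (phi C = 10 \<longrightarrow> near_clique C)"
proof -
  have fin: "finite C" using C by (auto intro: card_ge_0_finite)
  show ?thesis
  proof (cases "\<exists>S. dissociation_set C E S \<and> 3 \<le> card S")
    case True
    then obtain S where S: "dissociation_set C E S" "3 \<le> card S" by blast
    have "v \<notin> F" if F: "F \<in> mds C" for F
    proof
      assume vF: "v \<in> F"
      have "3 \<le> card F" using mds_card_ge[OF F S(1)] S(2) by simp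
      then have "2 \<le> card (F - {v})" using vF finite_member_mds[OF fin F] by simp
      then obtain A where "A \<subseteq> F - {v}" "card A = 2"
        using obtain_subset_with_card_n[of 2 "F - {v}"] by blast
      then obtain y z where "y \<in> F - {v}" "z \<in> F - {v}" "y \<noteq> z"
        by (auto simp: card_2_iff)
      moreover from this have "E v y" "E v z"
        using nv mds_subset[OF F] by (auto simp: nbrs_def)
      ultimately show False using mds_matching[OF fin F vF] by blast
    qed
    then have "mds C = {F \<in> mds C. v \<notin> F}" by blast
    then have "real (phi C) \<le> growth ^ card C * decay"
      using card_avoiding_le[OF fin bd v] by (simp add: phi_eq)
    then have "real (phi C) < 10" using C growth_power5 decay_less by simp
    then show ?thesis by simp
  next
    case False
    then have le2: "card F \<le> 2" if "dissociation_set C E F" for F using that by force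
    have "y = z" if "x \<in> C" "y \<in> C" "z \<in> C" "y \<noteq> x" "z \<noteq> x" "\<not> E x y" "\<not> E x z" for x y z
    proof (rule ccontr)
      assume "y \<noteq> z"
      then have "dissociation_set C E {x, y, z}"
        using that irrefl sym[of y x] sym[of z x] fin by (subst dissociation_iff) auto
      moreover have "card {x, y, z} = 3" using that \<open>y \<noteq> z\<close> by simp
      ultimately show False using le2[of "{x, y, z}"] by linarith
    qed
    then have "near_clique C" unfolding near_clique_def using C by blast
    then show ?thesis using phi_eq_10_if_card_le_2[OF C le2] by simp
  qed
qed

section \<open>Disjoint unions and the main induction\<close>

definition near_clique_partition :: "'a set \<Rightarrow> 'a set set \<Rightarrow> bool" where
  "near_clique_partition U P \<longleftrightarrow> partition_on U P \<and> (\<forall>B\<in>P. near_clique B) \<and>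
    (\<forall>B\<in>P. \<forall>B'\<in>P. B \<noteq> B' \<longrightarrow> (\<forall>x\<in>B. \<forall>y\<in>B'. \<not> E x y))"

lemma card_near_clique_partition:
  assumes "near_clique_partition U P"
  shows "card U = 5 * card P"
proof -
  have "card B = 5 \<and> finite B" if "B \<in> P" for B
    using assms that by (auto simp: near_clique_partition_def near_clique_def intro: card_ge_0_finite)
  then show ?thesis
    using assms product_partition[of U P] by (simp add: near_clique_partition_def)
qed

lemma phi_empty: "phi {} = 1"
proof -
  have "mds {} = {{}}"
    by (auto simp: mds_def max_dissociation_set_def dissociation_set_def)
  then show ?thesis by (simp add: phi_eq)
qed

text \<open>No edge leaves a block, so splitting one off divides \<open>phi\<close> by 10, down to
  the empty graph, whose only maximum set is empty.\<close>

lemma phi_near_clique_partition: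
  assumes "finite P" "near_clique_partition U P"
  shows "phi U = 10 ^ card P"
  using assms
proof (induction P arbitrary: U rule: finite_induct)
  case empty
  then have "U = {}" by (auto simp: near_clique_partition_def partition_on_def)
  then show ?case by (simp add: phi_empty)
next
  case (insert B P)
  have part: "partition_on U (insert B P)"
    using insert.prems by (simp add: near_clique_partition_def)
  have U: "U = B \<union> \<Union>P" using partition_onD1[OF part] by simp
  have disj: "disjnt B (\<Union>P)"
    using partition_onD2[OF part] insert.hyps(2) by (auto simp: disjoint_def disjnt_def)
  then have "near_clique_partition (U - B) P"
    using insert.prems part partition_on_insert[OF disj, of U] by (auto simp: near_clique_partition_def)
  moreover have "U - B = \<Union>P" using U disj by (auto simp: disjnt_def)
  moreover have "phi U = phi B * phi (U - B)"
  proof (rule phi_union_closed)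
    have "card U = 5 * card (insert B P)" using card_near_clique_partition[OF insert.prems] .
    then show "finite U" using insert.hyps by (auto intro: card_ge_0_finite)
    show "B \<subseteq> U" using U by blast
    fix a w assume "a \<in> B" "w \<in> U - B"
    then obtain B' where "B' \<in> P" "w \<in> B'" using \<open>U - B = \<Union>P\<close> by blast
    then have "B' \<noteq> B" using insert.hyps(2) by blast
    then show "\<not> E a w"
      using \<open>a \<in> B\<close> \<open>B' \<in> P\<close> \<open>w \<in> B'\<close> insert.prems
      unfolding near_clique_partition_def by blast
  qed
  ultimately show ?case
    using insert phi_near_clique[of B] by (simp add: near_clique_partition_def)
qed

text \<open>For nonempty \<open>U\<close> the bound is strict unless the closed neighbourhood of
  some vertex of degree 4 is a component; in that case \<open>phi\<close> factorises over this
  component and the rest.\<close>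

lemma phi_bound:
  assumes "finite U"
  shows "real (phi U) \<le> growth ^ card U \<and>
    (real (phi U) = growth ^ card U \<longrightarrow> (\<exists>P. near_clique_partition U P))"
  using assms
proof (induction U rule: finite_psubset_induct)
  case (psubset U)
  note fin = psubset.hyps
  have bd: "bounded_on_proper_subsets U"
    unfolding bounded_on_proper_subsets_def using psubset.IH by blast
  show ?case
  proof (cases "U = {}")
    case True
    then have "near_clique_partition U {}"
      by (simp add: near_clique_partition_def partition_on_empty)
    then show ?thesis using True phi_empty by auto
  next
    case ne: False
    show ?thesis
    proof (cases "\<exists>v\<in>U. card (nbrs U v) = 4 \<and> (\<forall>w\<in>nbrs U v. outer U v w = {})")
      case False
      have "real (phi U) < growth ^ card U"
      proof (cases "\<forall>v\<in>U. card (nbrs U v) \<le> 3")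
        case True
        then show ?thesis using phi_subcubic[OF fin bd ne] by blast
      next
        case False': False
        then obtain v where v: "v \<in> U" "card (nbrs U v) = 4 \<or> 5 \<le> card (nbrs U v)" by force
        then show ?thesis
          using phi_degree_ge5[OF fin bd v(1)] phi_degree4_open[OF fin bd v(1)] False by blast
      qed
      then show ?thesis by simp
    next
      case True
      then obtain v where v: "v \<in> U" "card (nbrs U v) = 4"
        and out: "\<And>w. w \<in> nbrs U v \<Longrightarrow> outer U v w = {}" by blast
      define C where "C = cnbrs U v"
      have "card C = 5" using v(2) by (simp add: C_def card_cnbrs[OF fin])
      moreover have "C \<subseteq> U" "v \<in> C"
        using cnbrs_subset[OF v(1)] by (simp_all add: C_def cnbrs_def)
      ultimately have C: "card C = 5" "C \<subseteq> U" "v \<in> C" by blast+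
      have sep: "\<not> E a w" if "a \<in> C" "w \<in> U - C" for a w
        using that out[of a] by (auto simp: C_def outer_def cnbrs_def nbrs_def)
      have "nbrs C v = C - {v}"
        using irrefl by (auto simp: C_def cnbrs_def nbrs_def)
      then have phiC: "phi C \<le> 10" "phi C = 10 \<Longrightarrow> near_clique C"
        using phi_five_dominated[OF C(1) bounded_on_proper_subsets_subset[OF bd C(2)] C(3)] by auto
      have rest: "real (phi (U - C)) \<le> growth ^ card (U - C)"
        "real (phi (U - C)) = growth ^ card (U - C) \<Longrightarrow> \<exists>P. near_clique_partition (U - C) P"
        using psubset.IH[of "U - C"] C by auto
      have prod: "phi U = phi C * phi (U - C)"
        using phi_union_closed[OF fin C(2) sep] by blast
      have "card U = 5 + card (U - C)"
        using C fin card_mono[OF fin C(2)] finite_subset[OF C(2) fin] by (simp add: card_Diff_subset)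
      then have pow: "growth ^ card U = 10 * growth ^ card (U - C)"
        by (simp add: power_add growth_power5)
      have pos: "growth ^ card (U - C) > 0" using growth_pos by simp
      have le: "real (phi U) \<le> growth ^ card U"
        unfolding prod pow using phiC(1) rest(1) by (simp add: mult_mono)
      moreover have "\<exists>P. near_clique_partition U P" if eq: "real (phi U) = growth ^ card U"
      proof -
        have eq': "real (phi C) * real (phi (U - C)) = 10 * growth ^ card (U - C)"
          using eq unfolding prod pow by simp
        \<comment> \<open>Equality in the product forces equality in both factors: bounding the
          second forces \<open>phi C = 10\<close>, and cancelling 10 makes the second
          extremal.\<close>
        have "real (phi C) * real (phi (U - C)) \<le> real (phi C) * growth ^ card (U - C)"
          using rest(1) by (intro mult_left_mono) auto
        then have "10 \<le> real (phi C)" using eq' pos by simp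
        then have ten: "phi C = 10" using phiC(1) by simp
        then have "real (phi (U - C)) = growth ^ card (U - C)" using eq' by simp
        then obtain P where P: "near_clique_partition (U - C) P" using rest(2) by blast
        then have UP: "\<Union>P = U - C" by (simp add: near_clique_partition_def partition_on_def)
        have "partition_on U (insert C P)"
          using P C UP by (subst partition_on_insert)
            (auto simp: near_clique_partition_def disjnt_def)
        moreover have "\<not> E x y \<and> \<not> E y x" if "B \<in> P" "x \<in> C" "y \<in> B" for B x y
          using sep[of x y] that UP sym by blast
        ultimately have "near_clique_partition U (insert C P)"
          using P phiC(2)[OF ten] unfolding near_clique_partition_def by blast
        then show ?thesis by blast
      qed
      ultimately show ?thesis by blast
    qed
  qed
qed

end

theorem theorem1p3:
  fixes V :: "'a set" and E :: "'a \<Rightarrow> 'a \<Rightarrow> bool"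
  assumes "simple_graph V E"
  defines "n \<equiv> card V"
  shows "real (num_max_dissociation V E) \<le> 10 powr (real n / 5)
    \<and> (real (num_max_dissociation V E) = 10 powr (real n / 5) \<longleftrightarrow>
         n mod 5 = 0 \<and> disjoint_union_K5_minus_matchings V E (n div 5))"
proof -
  interpret edge_relation E
    using assms(1) by unfold_locales (auto simp: simple_graph_def)
  have fin: "finite V" using assms(1) by (simp add: simple_graph_def)
  have union_iff: "disjoint_union_K5_minus_matchings V E k \<longleftrightarrow>
      (\<exists>P. near_clique_partition V P \<and> card P = k)" for k
    unfolding disjoint_union_K5_minus_matchings_def near_clique_partition_def
      near_clique_iff_induced_iso by blast
  have "real (phi V) = growth ^ n" if "near_clique_partition V P" for P
  proof -
    have "finite P"
      using that finite_elements[OF fin] by (simp add: near_clique_partition_def)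
    then have "real (phi V) = (growth ^ 5) ^ card P"
      using phi_near_clique_partition that by (simp add: growth_power5)
    then show ?thesis
      unfolding n_def card_near_clique_partition[OF that] by (simp add: power_mult)
  qed
  \<comment> \<open>Blocks have five elements, so any such partition has \<open>n div 5\<close>
    blocks and forces divisibility.\<close>
  moreover have "n mod 5 = 0 \<and> card P = n div 5" if "near_clique_partition V P" for P
    using card_near_clique_partition[OF that] by (simp add: n_def)
  ultimately show ?thesis
    using phi_bound[OF fin] unfolding union_iff growth_power[symmetric] n_def by blast
qed

end
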